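(* Let $X$ be a connected square-tiled surface of genus at least $2$, and let $\theta$ be a direction whose slope $\tan\theta$ is irrational. Then the linear flow in direction $\theta$ on $X$ (with respect to the normalized Lebesgue area measure) is rigid if and only if $\tan\theta$ has unbounded partial quotients.
   Context: A square-tiled surface is obtained from finitely many unit squares labelled $1,\dots,d$ by gluing, by translations, the right side of square $i$ to the left side of square $\tau(i)$ and the top side of square $i$ to the bottom side of square $\sigma(i)$, where $\tau,\sigma$ are permutations of $\{1,\dots,d\}$. The surface is connected if and only if the group generated by $\tau$ and $\sigma$ acts transitively on $\{1,\dots,d\}$. It is a translation surface (a finite branched cover of $\mathbb{R}^2/\mathbb{Z}^2$ ramified at most over the origin). For a direction $\theta$, the linear flow $(S_t)$ in direction $\theta$ moves points at unit speed along straight lines of direction $\theta$; it preserves Lebesgue area and is defined almost everywhere for all times. A measure-preserving flow $(S_t)$ on a probability space $(X,\mu)$ is rigid if there is a sequence of real numbers $Q_n\to\infty$ such that $\mu(S_{Q_n}A\,\Delta\,A)\to 0$ for every measurable set $A$. An irrational number has bounded (resp. unbounded) partial quotients if the partial quotients of its continued fraction expansion form a bounded (resp. unbounded) sequence. *)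

theory Defs
  imports "HOL-Probability.Probability" "HOL-Combinatorics.Permutations"
begin

section \<open>Square-tiled surfaces\<close>

type_synonym point = "nat \<times> real \<times> real"

definition squares :: "nat \<Rightarrow> point set" where
  "squares d = {1..d} \<times> {0..1} \<times> {0..1}"

definition glue_sides :: "nat \<Rightarrow> (nat \<Rightarrow> nat) \<Rightarrow> (nat \<Rightarrow> nat) \<Rightarrow> (point \<times> point) set" where
  "glue_sides d \<tau> \<sigma> =
     {((i, 1, y), (\<tau> i, 0, y)) | i y. i \<in> {1..d} \<and> y \<in> {0..1}} \<union>
     {((i, x, 1), (\<sigma> i, x, 0)) | i x. i \<in> {1..d} \<and> x \<in> {0..1}}"

definition glued :: "nat \<Rightarrow> (nat \<Rightarrow> nat) \<Rightarrow> (nat \<Rightarrow> nat) \<Rightarrow> (point \<times> point) set" where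
  "glued d \<tau> \<sigma> = (glue_sides d \<tau> \<sigma> \<union> (glue_sides d \<tau> \<sigma>)\<inverse>)\<^sup>*"

definition proj :: "nat \<Rightarrow> (nat \<Rightarrow> nat) \<Rightarrow> (nat \<Rightarrow> nat) \<Rightarrow> point \<Rightarrow> point set" where
  "proj d \<tau> \<sigma> p = glued d \<tau> \<sigma> `` {p}"

definition surface :: "nat \<Rightarrow> (nat \<Rightarrow> nat) \<Rightarrow> (nat \<Rightarrow> nat) \<Rightarrow> point set set" where
  "surface d \<tau> \<sigma> = proj d \<tau> \<sigma> ` squares d"

definition surface_topology :: "nat \<Rightarrow> (nat \<Rightarrow> nat) \<Rightarrow> (nat \<Rightarrow> nat) \<Rightarrow> point set topology" where
  "surface_topology d \<tau> \<sigma> = topology (\<lambda>U. U \<subseteq> surface d \<tau> \<sigma> \<and>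
     openin (top_of_set (squares d)) {p \<in> squares d. proj d \<tau> \<sigma> p \<in> U})"

lemma openin_surface_topology:
  "openin (surface_topology d \<tau> \<sigma>) U \<longleftrightarrow> U \<subseteq> surface d \<tau> \<sigma> \<and>
     openin (top_of_set (squares d)) {p \<in> squares d. proj d \<tau> \<sigma> p \<in> U}"
proof -
  let ?P = "\<lambda>U. {p \<in> squares d. proj d \<tau> \<sigma> p \<in> U}"
  have int: "?P (U \<inter> V) = ?P U \<inter> ?P V" for U V by auto
  have un: "?P (\<Union> K) = \<Union> (?P ` K)" for K by auto
  have "istopology (\<lambda>U. U \<subseteq> surface d \<tau> \<sigma> \<and> openin (top_of_set (squares d)) (?P U))"
    unfolding istopology_def int un by blast
  then show ?thesis
    by (simp add: surface_topology_def)
qed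

lemma quotient_map_proj:
  "quotient_map (top_of_set (squares d)) (surface_topology d \<tau> \<sigma>) (proj d \<tau> \<sigma>)"
proof -
  have "{p \<in> squares d. proj d \<tau> \<sigma> p \<in> surface d \<tau> \<sigma>} = squares d"
    by (auto simp: surface_def)
  then have "openin (surface_topology d \<tau> \<sigma>) (surface d \<tau> \<sigma>)"
    by (simp add: openin_surface_topology)
  then have "topspace (surface_topology d \<tau> \<sigma>) = surface d \<tau> \<sigma>"
    by (meson openin_subset openin_surface_topology openin_topspace subset_antisym)
  then show ?thesis
    by (auto simp: quotient_map_def openin_surface_topology surface_def)
qed

definition vertices :: "nat \<Rightarrow> (nat \<Rightarrow> nat) \<Rightarrow> (nat \<Rightarrow> nat) \<Rightarrow> point set set" where
  "vertices d \<tau> \<sigma> = proj d \<tau> \<sigma> ` ({1..d} \<times> {0, 1} \<times> {0, 1})"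

(* V - E + F for the cell structure given by the squares: F = d, and E = 2 * d because the
   4 * d sides are glued in pairs. *)
definition euler_char :: "nat \<Rightarrow> (nat \<Rightarrow> nat) \<Rightarrow> (nat \<Rightarrow> nat) \<Rightarrow> int" where
  "euler_char d \<tau> \<sigma> = int (card (vertices d \<tau> \<sigma>)) - int (2 * d) + int d"

(* Meaningful for connected surfaces, which are closed and oriented: euler_char = 2 - 2 * genus. *)
definition genus :: "nat \<Rightarrow> (nat \<Rightarrow> nat) \<Rightarrow> (nat \<Rightarrow> nat) \<Rightarrow> int" where
  "genus d \<tau> \<sigma> = (2 - euler_char d \<tau> \<sigma>) div 2"

section \<open>Normalized area\<close>

definition squares_area :: "nat \<Rightarrow> point measure" where
  "squares_area d = uniform_count_measure {1..d} \<Otimes>\<^sub>M restrict_space lborel ({0..1} \<times> {0..1})"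

(* Push-forward to the quotient, whose measurable sets are those with measurable preimage. *)
definition surface_area :: "nat \<Rightarrow> (nat \<Rightarrow> nat) \<Rightarrow> (nat \<Rightarrow> nat) \<Rightarrow> point set measure" where
  "surface_area d \<tau> \<sigma> = distr (squares_area d)
     (sigma (surface d \<tau> \<sigma>)
        {A. A \<subseteq> surface d \<tau> \<sigma> \<and> {p \<in> squares d. proj d \<tau> \<sigma> p \<in> A} \<in> sets (squares_area d)})
     (proj d \<tau> \<sigma>)"

lemma space_squares_area: "space (squares_area d) = squares d"
  by (simp add: squares_area_def squares_def space_pair_measure space_restrict_space
      uniform_count_measure_def space_point_measure)

lemma sets_surface_area:
  "sets (surface_area d \<tau> \<sigma>) =
     {A. A \<subseteq> surface d \<tau> \<sigma> \<and> {p \<in> squares d. proj d \<tau> \<sigma> p \<in> A} \<in> sets (squares_area d)}"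
    (is "_ = ?\<A>")
proof -
  let ?P = "\<lambda>U. {p \<in> squares d. proj d \<tau> \<sigma> p \<in> U}"
  have "sigma_algebra (surface d \<tau> \<sigma>) ?\<A>"
    unfolding sigma_algebra_iff2
  proof (intro conjI ballI allI impI)
    show "?\<A> \<subseteq> Pow (surface d \<tau> \<sigma>)" "{} \<in> ?\<A>" by auto
  next
    fix A assume A: "A \<in> ?\<A>"
    have "?P (surface d \<tau> \<sigma> - A) = space (squares_area d) - ?P A"
      by (auto simp: surface_def space_squares_area)
    with A show "surface d \<tau> \<sigma> - A \<in> ?\<A>" by auto
  next
    fix A :: "nat \<Rightarrow> point set set" assume A: "range A \<subseteq> ?\<A>"
    have "?P (\<Union> (range A)) = (\<Union>n. ?P (A n))" by auto
    with A show "\<Union> (range A) \<in> ?\<A>" by (auto intro!: sets.countable_UN)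
  qed
  then show ?thesis
    by (simp add: surface_area_def sigma_algebra.sets_measure_of_eq)
qed

section \<open>Linear flow\<close>

definition unit_vector :: "real \<Rightarrow> real \<times> real" where
  "unit_vector \<theta> = (cos \<theta>, sin \<theta>)"

(* A bi-infinite unit-speed straight line: just after and just before each time s the curve moves
   inside one closed square. The two squares may differ when the point at time s is on an edge;
   all vertices are avoided, even those of cone angle 2 pi, which affects only a null set. *)
definition straight_line ::
    "nat \<Rightarrow> (nat \<Rightarrow> nat) \<Rightarrow> (nat \<Rightarrow> nat) \<Rightarrow> real \<Rightarrow> (real \<Rightarrow> point set) \<Rightarrow> bool" where
  "straight_line d \<tau> \<sigma> \<theta> \<gamma> \<longleftrightarrow> (\<forall>s. \<gamma> s \<notin> vertices d \<tau> \<sigma> \<and>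
     (\<exists>\<epsilon>>0. \<exists>i z. \<forall>r\<in>{0..\<epsilon>}. (i, z + r *\<^sub>R unit_vector \<theta>) \<in> squares d \<and>
        \<gamma> (s + r) = proj d \<tau> \<sigma> (i, z + r *\<^sub>R unit_vector \<theta>)) \<and>
     (\<exists>\<epsilon>>0. \<exists>i z. \<forall>r\<in>{0..\<epsilon>}. (i, z - r *\<^sub>R unit_vector \<theta>) \<in> squares d \<and>
        \<gamma> (s - r) = proj d \<tau> \<sigma> (i, z - r *\<^sub>R unit_vector \<theta>)))"

(* Points whose line meets a vertex in the past or in the future form a null set; they are left
   fixed, so that the flow is a group of bijections of the whole surface. *)
definition linear_flow ::
    "nat \<Rightarrow> (nat \<Rightarrow> nat) \<Rightarrow> (nat \<Rightarrow> nat) \<Rightarrow> real \<Rightarrow> real \<Rightarrow> point set \<Rightarrow> point set" where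
  "linear_flow d \<tau> \<sigma> \<theta> t p =
     (if \<exists>\<gamma>. straight_line d \<tau> \<sigma> \<theta> \<gamma> \<and> \<gamma> 0 = p
      then (THE \<gamma>. straight_line d \<tau> \<sigma> \<theta> \<gamma> \<and> \<gamma> 0 = p) t else p)"

section \<open>Rigidity\<close>

definition measure_preserving_flow :: "'a measure \<Rightarrow> (real \<Rightarrow> 'a \<Rightarrow> 'a) \<Rightarrow> bool" where
  "measure_preserving_flow M S \<longleftrightarrow> prob_space M \<and>
     (\<forall>x\<in>space M. S 0 x = x) \<and>
     (\<forall>s t. \<forall>x\<in>space M. S (s + t) x = S s (S t x)) \<and>
     (\<forall>t. S t \<in> measurable M M \<and> distr M M (S t) = M)"

definition rigid :: "'a measure \<Rightarrow> (real \<Rightarrow> 'a \<Rightarrow> 'a) \<Rightarrow> bool" where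
  "rigid M S \<longleftrightarrow> measure_preserving_flow M S \<and>
     (\<exists>Q :: nat \<Rightarrow> real. filterlim Q at_top sequentially \<and>
        (\<forall>A\<in>sets M. (\<lambda>n. measure M (sym_diff (S (Q n) ` A) A)) \<longlonglongrightarrow> 0))"

section \<open>Continued fractions\<close>

(* For irrational x no complete quotient is an integer, so the division is never by 0. *)
fun complete_quotient :: "real \<Rightarrow> nat \<Rightarrow> real" where
  "complete_quotient x 0 = x"
| "complete_quotient x (Suc n) = 1 / frac (complete_quotient x n)"

definition partial_quotient :: "real \<Rightarrow> nat \<Rightarrow> int" where
  "partial_quotient x n = \<lfloor>complete_quotient x n\<rfloor>"

definition unbounded_partial_quotients :: "real \<Rightarrow> bool" where
  "unbounded_partial_quotients x \<longleftrightarrow> \<not> bounded (range (partial_quotient x))"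

end

theory Submission
  imports Defs "HOL-Combinatorics.Cycles"
begin

text \<open>A line of slope \<open>\<alpha>\<close> that misses the lattice lifts to the surface once its square label is
  known: in the cell \<open>(m, n)\<close> of the plane the label is \<open>\<sigma>\<^sup>n g\<^sub>m\<close> applied to the initial one, where
  \<open>g\<^sub>m = (\<sigma>\<^sup>-\<^sup>n \<tau> \<sigma>\<^sup>n) g\<^sub>m\<^sub>-\<^sub>1\<close> and \<open>n\<close> is the row in which the line crosses the vertical \<open>x = m\<close>. The flow
  is thus a permutation-valued cocycle over the linear flow of the torus.

  If the partial quotients are unbounded, there are fractions \<open>p/q\<close> with \<open>q |q \<alpha> - p|\<close> arbitrarily
  small. Up to a set of small measure the flow along \<open>N (q, q \<alpha>)\<close> then crosses the same sides in each of its \<open>N\<close>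
  passages, so its cocycle is an \<open>N\<close>-th power, which is trivial when \<open>N\<close> is a common period of
  all permutations of the squares; hence it is close to the identity.

  If they are bounded, then \<open>q |q \<alpha> - p| \<ge> \<kappa>\<close> for all \<open>q \<ge> 1\<close>. For a long flow time, with
  \<open>x\<close>-displacement about \<open>m\<close>, on a set of measure about \<open>\<kappa>\<close> raising the starting point by \<open>\<kappa> / m\<close>
  pushes the path over exactly one lattice point. This changes the cocycle, because \<open>\<tau>\<close> and \<open>\<sigma>\<close>
  do not commute when the genus is at least 2. So a set of measure bounded below changes
  squares, at all large times.\<close>

section \<open>Continued fractions\<close>

text \<open>Each crossing of a vertical side is carried back to row 0 by conjugation with \<sigma>,
  so crossings of horizontal sides leave no trace but the final power of \<sigma>. What counts are
  the rows \<lfloor>b + \<alpha> k\<rfloor> at the integer verticals, whatever the sign of the slope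
  and the order in which sides are met. Comparing two lines thus means comparing floors. One
  near-period (q, p) is not enough for rigidity, because the permutation picked up along it need not
  be the identity. As there are finitely many permutations, one N serves all convergents, and the
  error stays a fixed multiple of q |q \<alpha> - p|. In the bounded case the height of the push is
  constrained from two sides: at most \<kappa> divided by the number of columns, so that no line is
  pushed over two lattice points, but still of that order, so that the points affected fill a fixed
  proportion of the square. The test sets are the open squares, on which a change of label is
  visible.\<close>

fun cf_den :: "real \<Rightarrow> nat \<Rightarrow> int" where
  "cf_den x 0 = 0"
| "cf_den x (Suc 0) = 1"
| "cf_den x (Suc (Suc n)) = partial_quotient x (Suc n) * cf_den x (Suc n) + cf_den x n"

text \<open>Convergents with the index shifted by one: \<open>cf_num x (Suc n)\<close> and
  \<open>cf_den x (Suc n)\<close> are the usual p_n and q_n, and index 0 holds the conventional pair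
  (1, 0), so that the recursion needs no negative index.\<close>

fun cf_num :: "real \<Rightarrow> nat \<Rightarrow> int" where
  "cf_num x 0 = 1"
| "cf_num x (Suc 0) = partial_quotient x 0"
| "cf_num x (Suc (Suc n)) = partial_quotient x (Suc n) * cf_num x (Suc n) + cf_num x n"

definition cf_err :: "real \<Rightarrow> nat \<Rightarrow> real" where
  "cf_err x n = of_int (cf_den x n) * x - of_int (cf_num x n)"

lemma complete_quotient_irrational:
  assumes "x \<notin> \<rat>"
  shows "complete_quotient x n \<notin> \<rat>"
proof (induction n)
  case (Suc n)
  show ?case
  proof
    assume "complete_quotient x (Suc n) \<in> \<rat>"
    then have "1 / complete_quotient x (Suc n) \<in> \<rat>" by (intro Rats_divide) auto
    then have "frac (complete_quotient x n) + of_int \<lfloor>complete_quotient x n\<rfloor> \<in> \<rat>"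
      by (intro Rats_add) simp_all
    with Suc show False by (simp add: frac_def)
  qed
qed (use assms in simp)

lemma frac_complete_quotient_pos:
  assumes "x \<notin> \<rat>"
  shows "frac (complete_quotient x n) > 0"
  using complete_quotient_irrational[OF assms, of n] Ints_subset_Rats by (auto simp: frac_gt_0_iff)

lemma complete_quotient_Suc_gt_1:
  assumes "x \<notin> \<rat>"
  shows "complete_quotient x (Suc n) > 1"
  using frac_complete_quotient_pos[OF assms, of n] frac_lt_1[of "complete_quotient x n"]
  by simp

lemma partial_quotient_Suc_ge_1:
  assumes "x \<notin> \<rat>"
  shows "partial_quotient x (Suc n) \<ge> 1"
  using complete_quotient_Suc_gt_1[OF assms, of n]
  by (simp add: partial_quotient_def del: complete_quotient.simps)

lemma cf_den_mono_pos:
  assumes "x \<notin> \<rat>"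
  shows "cf_den x n \<ge> 0 \<and> cf_den x (Suc n) \<ge> cf_den x n \<and> cf_den x (Suc n) \<ge> 1"
proof (induction n)
  case (Suc n)
  have "1 * cf_den x (Suc n) \<le> partial_quotient x (Suc n) * cf_den x (Suc n)"
    using partial_quotient_Suc_ge_1[OF assms, of n] Suc by (intro mult_right_mono) auto
  moreover have "cf_den x (Suc (Suc n)) = partial_quotient x (Suc n) * cf_den x (Suc n) + cf_den x n"
    by simp
  ultimately show ?case using Suc by linarith
qed auto

lemma cf_den_unbounded:
  assumes "x \<notin> \<rat>"
  shows "cf_den x (Suc n) \<ge> int n"
proof (induction n rule: less_induct)
  case (less n)
  note pos = cf_den_mono_pos[OF assms]
  show ?case
  proof (cases n)
    case (Suc k)
    show ?thesis
    proof (cases k)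
      case (Suc l)
      have "1 * cf_den x (Suc k) \<le> partial_quotient x (Suc k) * cf_den x (Suc k)"
        using partial_quotient_Suc_ge_1[OF assms, of k] pos[of k] by (intro mult_right_mono) auto
      moreover have "cf_den x k \<ge> 1" using pos[of l] Suc by auto
      moreover have "cf_den x (Suc k) \<ge> int k" using less[of k] \<open>n = Suc k\<close> by simp
      ultimately show ?thesis using \<open>n = Suc k\<close> by simp
    qed (use \<open>n = Suc k\<close> pos[of 1] in simp)
  qed simp
qed

lemma cf_err_Suc_Suc:
  "cf_err x (Suc (Suc n)) = of_int (partial_quotient x (Suc n)) * cf_err x (Suc n) + cf_err x n"
  by (simp add: cf_err_def algebra_simps)

text \<open>Inserting the ratio known for n into the error recursion leaves minus the fractional
  part of the complete quotient as the next ratio, and the reciprocal of that part is the next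
  complete quotient.\<close>

lemma cf_err_complete_quotient:
  assumes "x \<notin> \<rat>"
  shows "cf_err x n = - complete_quotient x (Suc n) * cf_err x (Suc n)"
proof (induction n)
  case 0
  show ?case using frac_complete_quotient_pos[OF assms, of 0]
    by (simp add: cf_err_def partial_quotient_def frac_def)
next
  case (Suc n)
  have "cf_err x (Suc (Suc n)) = - frac (complete_quotient x (Suc n)) * cf_err x (Suc n)"
    unfolding cf_err_Suc_Suc Suc by (simp add: partial_quotient_def frac_def algebra_simps)
  then show ?case
    using frac_complete_quotient_pos[OF assms, of "Suc n"]
    by (simp del: complete_quotient.simps add: complete_quotient.simps(2)[of x "Suc n"])
qed

lemma cf_determinant:
  "\<bar>cf_den x (Suc n) * cf_num x n - cf_den x n * cf_num x (Suc n)\<bar> = 1"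
proof (induction n)
  case (Suc n)
  have "cf_den x (Suc (Suc n)) * cf_num x (Suc n) - cf_den x (Suc n) * cf_num x (Suc (Suc n))
      = - (cf_den x (Suc n) * cf_num x n - cf_den x n * cf_num x (Suc n))"
    by (simp add: algebra_simps)
  with Suc show ?case by simp
qed simp

text \<open>Eliminating x between two consecutive errors leaves the determinant of the convergents.
  This gives an exact formula for the error, from which both approximation results are
  derived.\<close>

lemma cf_err_abs:
  assumes "x \<notin> \<rat>"
  shows "\<bar>cf_err x (Suc n)\<bar> *
    (of_int (cf_den x (Suc n)) * complete_quotient x (Suc n) + of_int (cf_den x n)) = 1"
proof -
  let ?K = "of_int (cf_den x (Suc n)) * complete_quotient x (Suc n) + of_int (cf_den x n) :: real"
  have pos: "?K \<ge> 0"
    using cf_den_mono_pos[OF assms, of n] complete_quotient_Suc_gt_1[OF assms, of n] by simp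
  have "cf_err x (Suc n) * ?K
      = of_int (cf_den x n) * cf_err x (Suc n) - of_int (cf_den x (Suc n)) * cf_err x n"
    unfolding cf_err_complete_quotient[OF assms, of n] by (simp add: algebra_simps)
  also have "\<dots> = of_int (cf_den x (Suc n) * cf_num x n - cf_den x n * cf_num x (Suc n))"
    by (simp add: cf_err_def algebra_simps)
  finally have "\<bar>cf_err x (Suc n) * ?K\<bar> = 1"
    using cf_determinant[of x n] by (metis of_int_1 of_int_abs)
  with pos show ?thesis by (simp add: abs_mult)
qed

section \<open>Partial quotients and the size of q |q x - p|\<close>

text \<open>Just before a large partial quotient a convergent is exceptionally good: by
  \<open>cf_err_abs\<close>, q |q x - p| is at most the reciprocal of the next complete
  quotient.\<close>

lemma unbounded_partial_quotients_approx:
  fixes x :: real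
  assumes x: "x \<notin> \<rat>" and unb: "unbounded_partial_quotients x" and "\<epsilon> > 0"
  obtains q p :: int where "q \<ge> 1" "q \<ge> int K" "of_int q * \<bar>of_int q * x - of_int p\<bar> < \<epsilon>"
proof -
  \<comment> \<open>The sum puts the first partial quotients out of reach, so a quotient above B has
    index beyond K, and the convergent before it has denominator at least K. It also covers the
    quotient of index 0, which may be negative.\<close>
  define B where "B = \<lceil>1 / \<epsilon>\<rceil> + (\<Sum>k\<le>K. \<bar>partial_quotient x k\<bar>) + 1"
  obtain n where n: "partial_quotient x (Suc n) > B"
  proof (rule ccontr)
    assume "\<not> thesis"
    then have le: "partial_quotient x (Suc n) \<le> B" for n using that[of n] by force
    have 0: "\<bar>partial_quotient x 0\<bar> \<le> (\<Sum>k\<le>K. \<bar>partial_quotient x k\<bar>)"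
      by (intro member_le_sum) auto
    have "\<bar>partial_quotient x n\<bar> \<le> B" for n
    proof (cases "n = 0")
      case True
      have "\<lceil>1 / \<epsilon>\<rceil> \<ge> 0" using \<open>\<epsilon> > 0\<close> zero_le_ceiling[of "1 / \<epsilon>"] by (smt (verit) divide_pos_pos)
      then show ?thesis using 0 unfolding B_def True by linarith
    next
      case False
      then obtain k where "n = Suc k" by (metis not0_implies_Suc)
      then show ?thesis using le[of k] partial_quotient_Suc_ge_1[OF x, of k] by simp
    qed
    then have "\<bar>real_of_int (partial_quotient x n)\<bar> \<le> of_int B" for n
      by (metis of_int_abs of_int_le_iff)
    then have "\<not> unbounded_partial_quotients x"
      unfolding unbounded_partial_quotients_def bounded_iff by auto
    with unb show False by simp
  qed
  have "n \<ge> K"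
  proof (rule ccontr)
    assume "\<not> n \<ge> K"
    then have "\<bar>partial_quotient x (Suc n)\<bar> \<le> (\<Sum>k\<le>K. \<bar>partial_quotient x k\<bar>)"
      by (intro member_le_sum) auto
    moreover have "\<lceil>1 / \<epsilon>\<rceil> \<ge> 0" using \<open>\<epsilon> > 0\<close> zero_le_ceiling[of "1 / \<epsilon>"] by (smt (verit) divide_pos_pos)
    ultimately show False using n unfolding B_def by linarith
  qed
  let ?q = "cf_den x (Suc n)"
  let ?D = "\<bar>cf_err x (Suc n)\<bar>"
  have q: "?q \<ge> 1" "cf_den x n \<ge> 0" using cf_den_mono_pos[OF x, of n] by auto
  have cq: "complete_quotient x (Suc n) \<ge> of_int B"
    using n unfolding partial_quotient_def by linarith
  have "0 \<le> (\<Sum>k\<le>K. \<bar>partial_quotient x k\<bar>)" by (rule sum_nonneg) simp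
  then have "\<lceil>1 / \<epsilon>\<rceil> < B" unfolding B_def by linarith
  then have B: "real_of_int B > 1 / \<epsilon>" by linarith
  have Dpos: "?D > 0"
    using cf_err_abs[OF x, of n] by (metis abs_ge_zero mult_zero_left order_le_less zero_neq_one)
  have "of_int ?q * ?D * (1 / \<epsilon>) < of_int ?q * ?D * complete_quotient x (Suc n)"
    using q Dpos B cq by (intro mult_strict_left_mono) auto
  also have "\<dots> \<le> 1"
  proof -
    have "0 \<le> of_int (cf_den x n) * ?D" using q by simp
    then show ?thesis
      using cf_err_abs[OF x, of n] by (simp add: algebra_simps del: complete_quotient.simps)
  qed
  finally have "of_int ?q * ?D < \<epsilon>" using \<open>\<epsilon> > 0\<close> by (simp add: field_simps)
  moreover have "?q \<ge> int K" using cf_den_unbounded[OF x, of n] \<open>n \<ge> K\<close> by linarith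
  ultimately show ?thesis using that[of ?q "cf_num x (Suc n)"] q by (simp add: cf_err_def)
qed

text \<open>Legendre's argument: a fraction with q |q x - p| < 1/4 is a convergent up to a common
  factor, and for convergents the bound follows from \<open>cf_err_abs\<close>.\<close>

lemma bounded_partial_quotients_approx:
  fixes x :: real
  assumes x: "x \<notin> \<rat>" and bdd: "\<not> unbounded_partial_quotients x"
  obtains \<kappa> :: real where "\<kappa> > 0"
    "\<And>q p :: int. q \<ge> 1 \<Longrightarrow> \<kappa> \<le> of_int q * \<bar>of_int q * x - of_int p\<bar>"
proof -
  obtain A0 where A0: "\<And>n. \<bar>real_of_int (partial_quotient x n)\<bar> \<le> A0"
    using bdd by (auto simp: unbounded_partial_quotients_def bounded_iff)
  define A where "A = max A0 1"
  have A: "real_of_int (partial_quotient x n) \<le> A" for n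
    using A0[of n] by (simp add: A_def)
  have A1: "A \<ge> 1" by (simp add: A_def)
  have lower: "1 / (A + 2) \<le> of_int (cf_den x (Suc n)) * \<bar>cf_err x (Suc n)\<bar>" for n
  proof -
    let ?q = "real_of_int (cf_den x (Suc n))"
    have q: "?q \<ge> 1" "of_int (cf_den x n) \<le> ?q" using cf_den_mono_pos[OF x, of n] by auto
    have "complete_quotient x (Suc n) \<le> A + 1"
      using A[of "Suc n"] unfolding partial_quotient_def by linarith
    then have "?q * complete_quotient x (Suc n) \<le> ?q * (A + 1)"
      using q by (intro mult_left_mono) auto
    then have "?q * complete_quotient x (Suc n) + of_int (cf_den x n) \<le> ?q * (A + 2)"
      using q by (simp add: algebra_simps del: complete_quotient.simps)
    then have "1 \<le> \<bar>cf_err x (Suc n)\<bar> * (?q * (A + 2))"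
      using cf_err_abs[OF x, of n] by (metis abs_ge_zero mult_left_mono)
    then show ?thesis using A1 by (simp add: field_simps)
  qed
  have main: "min (1/4) (1 / (A + 2)) \<le> of_int q * \<bar>of_int q * x - of_int p\<bar>"
    if q1: "q \<ge> 1" for q p :: int
  proof (rule ccontr)
    assume "\<not> ?thesis"
    then have small: "of_int q * \<bar>of_int q * x - of_int p\<bar> < 1/4"
      and small2: "of_int q * \<bar>of_int q * x - of_int p\<bar> < 1 / (A + 2)" by auto
    \<comment> \<open>The convergent P/Q is chosen with Q \<le> 2 q and with the next denominator
      above 2 q. The first inequality gives Q |q x - p| < 1/2, the second q |Q x - P| \<le> 1/2, so
      the integer q P - p Q vanishes.\<close>
    define n where "n = (LEAST n. cf_den x (Suc (Suc n)) > 2 * q)"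
    have ex: "cf_den x (Suc (Suc (nat (2 * q)))) > 2 * q"
      using cf_den_unbounded[OF x, of "Suc (nat (2 * q))"] q1 by simp
    have n: "cf_den x (Suc (Suc n)) > 2 * q"
      unfolding n_def by (rule LeastI[of _ "nat (2*q)"]) (use ex in simp)
    have n': "cf_den x (Suc n) \<le> 2 * q"
    proof (cases n)
      case 0
      then show ?thesis using q1 by simp
    next
      case (Suc k)
      then have "\<not> cf_den x (Suc (Suc k)) > 2 * q"
        unfolding n_def by (metis lessI not_less_Least)
      then show ?thesis using Suc by simp
    qed
    let ?Q = "cf_den x (Suc n)" and ?P = "cf_num x (Suc n)" and ?D = "cf_err x (Suc n)"
    have Q: "?Q \<ge> 1" "cf_den x n \<ge> 0" using cf_den_mono_pos[OF x, of n] by auto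
    have "of_int (cf_den x (Suc (Suc n))) \<le>
        of_int ?Q * complete_quotient x (Suc n) + of_int (cf_den x n)"
      using mult_left_mono[OF of_int_floor_le[of "complete_quotient x (Suc n)"], of "of_int ?Q"] Q
      by (simp add: partial_quotient_def mult.commute del: complete_quotient.simps)
    then have "\<bar>?D\<bar> * of_int (cf_den x (Suc (Suc n))) \<le> 1"
      using cf_err_abs[OF x, of n] by (metis abs_ge_zero mult_left_mono)
    moreover have "\<bar>?D\<bar> * of_int (2 * q) \<le> \<bar>?D\<bar> * of_int (cf_den x (Suc (Suc n)))"
      using less_imp_le[OF n] by (intro mult_left_mono) (simp_all only: of_int_le_iff abs_ge_zero)
    ultimately have D: "of_int q * \<bar>?D\<bar> \<le> 1 / 2" by (simp add: algebra_simps)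
    have "of_int ?Q * \<bar>of_int q * x - of_int p\<bar> \<le> of_int (2 * q) * \<bar>of_int q * x - of_int p\<bar>"
      using n' by (intro mult_right_mono) auto
    also have "\<dots> < 1 / 2" using small by simp
    finally have "of_int ?Q * \<bar>of_int q * x - of_int p\<bar> + of_int q * \<bar>?D\<bar> < 1" using D by simp
    moreover have "real_of_int (q * ?P - p * ?Q)
        = of_int ?Q * (of_int q * x - of_int p) - of_int q * ?D"
      by (simp add: cf_err_def algebra_simps)
    then have "\<bar>real_of_int (q * ?P - p * ?Q)\<bar>
        \<le> of_int ?Q * \<bar>of_int q * x - of_int p\<bar> + of_int q * \<bar>?D\<bar>"
      using q1 Q abs_triangle_ineq4[of "of_int ?Q * (of_int q * x - of_int p)" "of_int q * ?D"]
      by (simp add: abs_mult)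
    ultimately have "\<bar>real_of_int (q * ?P - p * ?Q)\<bar> < 1" by linarith
    then have eq: "q * ?P = p * ?Q" by linarith
    have "coprime ?Q ?P"
    proof (rule coprimeI)
      fix c assume "c dvd ?Q" "c dvd ?P"
      then have "c dvd ?Q * cf_num x n - cf_den x n * ?P" by simp
      then have "c dvd \<bar>?Q * cf_num x n - cf_den x n * ?P\<bar>" by simp
      then show "is_unit c" by (simp only: cf_determinant)
    qed
    moreover have "?Q dvd q * ?P" using eq by simp
    ultimately have "?Q dvd q" by (simp add: coprime_dvd_mult_left_iff)
    then obtain j where j: "q = ?Q * j" by (auto simp: dvd_def)
    with eq Q have p: "p = j * ?P" by (auto simp: algebra_simps)
    have j1: "j \<ge> 1" using j q1 Q by (metis int_one_le_iff_zero_less zero_less_mult_pos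
          less_le_trans zero_less_one)
    have "of_int q * \<bar>of_int q * x - of_int p\<bar> = of_int j ^ 2 * (of_int ?Q * \<bar>?D\<bar>)"
    proof -
      have "of_int q * x - of_int p = of_int j * ?D"
        using j p by (simp add: cf_err_def algebra_simps)
      then show ?thesis using j j1 by (simp add: abs_mult power2_eq_square)
    qed
    moreover have "1 * (of_int ?Q * \<bar>?D\<bar>) \<le> of_int j ^ 2 * (of_int ?Q * \<bar>?D\<bar>)"
      using j1 Q by (intro mult_right_mono) auto
    ultimately show False using small2 lower[of n] by simp
  qed
  show ?thesis by (rule that[OF _ main]) (use A1 in auto)
qed

section \<open>Straight lines on square-tiled surfaces\<close>

definition int_iter :: "(int \<Rightarrow> 'a \<Rightarrow> 'a) \<Rightarrow> int \<Rightarrow> 'a \<Rightarrow> 'a" where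
  "int_iter h m = (if 0 \<le> m then rec_nat id (\<lambda>k f. h (int k + 1) \<circ> f) (nat m)
     else rec_nat id (\<lambda>k f. inv (h (- int k)) \<circ> f) (nat (- m)))"

lemma int_iter_0 [simp]: "int_iter h 0 = id"
  by (simp add: int_iter_def)

text \<open>Together with the value \<open>id\<close> at 0 this recursion characterises the product.
  For m > 0 it is h m \<circ> ... \<circ> h 1; for m < 0 the recursion is solved backwards, which
  makes \<open>inv (h 0)\<close> the first factor applied.\<close>

lemma int_iter_succ:
  assumes "\<And>k. bij (h k)"
  shows "int_iter h (m + 1) = h (m + 1) \<circ> int_iter h m"
proof (cases "0 \<le> m")
  case True
  then have "nat (m + 1) = Suc (nat m)" by simp
  with True show ?thesis by (simp add: int_iter_def)
next
  case False
  define k where "k = nat (- m - 1)"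
  have k: "nat (- m) = Suc k" "nat (- (m + 1)) = k" "- int k = m + 1"
    using False by (auto simp: k_def)
  have *: "h (m + 1) \<circ> (inv (h (m + 1)) \<circ> f) = f" for f :: "'a \<Rightarrow> 'a"
    using surj_f_inv_f[OF bij_is_surj[OF assms]] by (auto simp: fun_eq_iff)
  show ?thesis
  proof (cases "m = - 1")
    case True
    then show ?thesis using *[of id] by (simp add: int_iter_def)
  next
    case m: False
    then show ?thesis using False k * by (simp add: int_iter_def)
  qed
qed

lemma int_iter_pred:
  assumes "\<And>k. bij (h k)"
  shows "int_iter h (m - 1) = inv (h m) \<circ> int_iter h m"
  using int_iter_succ[of h "m - 1", OF assms] bij_is_inj[OF assms, of m]
  by (auto simp: fun_eq_iff)

lemma int_iter_permutes:
  assumes "\<And>k. h k permutes S"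
  shows "int_iter h m permutes S"
proof (induction m rule: int_induct[where k = 0])
  case base
  show ?case by (simp only: int_iter_0 permutes_id)
next
  case (step1 i)
  then show ?case
    using assms permutes_bij[OF assms] by (subst int_iter_succ) (auto intro: permutes_compose)
next
  case (step2 i)
  then show ?case
    using permutes_inv[OF assms] permutes_bij[OF assms]
    by (subst int_iter_pred) (auto intro: permutes_compose)
qed

lemma int_iter_add:
  fixes f :: "'a \<Rightarrow> 'a"
  assumes f: "bij f"
  shows "int_iter (\<lambda>_. f) (m + n) = int_iter (\<lambda>_. f) m \<circ> int_iter (\<lambda>_. f) n"
proof (induction m rule: int_induct[where k = 0])
  case (step1 i)
  have "i + 1 + n = (i + n) + 1" by simp
  then show ?case using step1 int_iter_succ[of "\<lambda>_. f", OF f] by (metis comp_assoc)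
next
  case (step2 i)
  have "i - 1 + n = (i + n) - 1" by simp
  then show ?case using step2 int_iter_pred[of "\<lambda>_. f", OF f] by (metis comp_assoc)
qed simp

text \<open>Cancellation in the group of bijections: common factors on the left go by injectivity,
  those on the right by surjectivity. Thus one altered crossing cannot be compensated by the
  others.\<close>

lemma int_iter_differ_once:
  assumes bij: "\<And>k. bij (h k)" "\<And>k. bij (h' k)"
    and k: "1 \<le> k" "k \<le> int m"
    and agree: "\<And>j. 1 \<le> j \<Longrightarrow> j \<le> int m \<Longrightarrow> j \<noteq> k \<Longrightarrow> h j = h' j"
    and eq: "int_iter h (int m) = int_iter h' (int m)"
  shows "h k = h' k"
  using k(2) agree eq
proof (induction m)
  case 0
  then show ?case using k(1) by simp
next
  case (Suc m)
  note agr = Suc.prems(2)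
  have step: "h (int m + 1) \<circ> int_iter h (int m) = h' (int m + 1) \<circ> int_iter h' (int m)"
    using Suc.prems(3) int_iter_succ[of h, OF bij(1)] int_iter_succ[of h', OF bij(2)]
    by (metis add.commute of_nat_Suc)
  show ?case
  proof (cases "k = int m + 1")
    case True
    have same: "int_iter h (int n) = int_iter h' (int n)" if "n \<le> m" for n
      using that
    proof (induction n)
      case (Suc n)
      have "h (int n + 1) = h' (int n + 1)"
        using agr[of "int n + 1"] Suc.prems True by simp
      moreover have "int (Suc n) = int n + 1" by simp
      ultimately show ?case
        using Suc int_iter_succ[of h, OF bij(1)] int_iter_succ[of h', OF bij(2)]
        by (simp only: Suc_leD)
    qed simp
    have "surj (int_iter h (int m))"
      using permutes_surj[OF int_iter_permutes[of h UNIV]] bij_imp_permutes[OF bij(1)] by auto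
    have "h (int m + 1) x = h' (int m + 1) x" for x
    proof -
      obtain y where "x = int_iter h (int m) y"
        using \<open>surj (int_iter h (int m))\<close> by (metis surjD)
      then show ?thesis using fun_cong[OF step, of y] same[of m] by simp
    qed
    then have "h (int m + 1) = h' (int m + 1)" by (rule ext)
    with True show ?thesis by simp
  next
    case False
    then have "h (int m + 1) = h' (int m + 1)" using Suc.prems(2)[of "int m + 1"] by simp
    then have "int_iter h (int m) = int_iter h' (int m)"
      using step bij_is_inj[OF bij(2), of "int m + 1"] by (auto simp: fun_eq_iff inj_eq)
    then show ?thesis using Suc False by simp
  qed
qed

lemma exists_common_period:
  assumes "finite S"
  obtains n :: nat where "n > 0" "\<And>p. p permutes S \<Longrightarrow> p ^^ n = id"
proof -
  have "\<forall>p\<in>{p. p permutes S}. \<exists>n>0. p ^^ n = id"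
    using assms permutation_is_nilpotent permutation_permutes by (metis mem_Collect_eq)
  then obtain N where N: "\<And>p. p permutes S \<Longrightarrow> N p > 0 \<and> p ^^ N p = id" by (metis mem_Collect_eq)
  let ?n = "\<Prod>p | p permutes S. N p"
  have fin: "finite {p. p permutes S}" using assms by (rule finite_permutations)
  have "?n > 0" using N by (intro prod_pos) auto
  moreover have "p ^^ ?n = id" if p: "p permutes S" for p
  proof -
    have "N p dvd ?n" using fin p by auto
    then obtain k where "?n = N p * k" by (auto simp: dvd_def)
    then show ?thesis using N[OF p] by (metis funpow_mult id_funpow)
  qed
  ultimately show ?thesis using that by blast
qed

section \<open>The gluing relation and the genus\<close>

text \<open>The means to show that two points are not identified: a function compatible with both
  kinds of side gluing is constant on classes. It is applied to labels, to fractional parts and to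
  representatives adapted to a direction.\<close>

lemma glued_invariant:
  assumes "(p, q) \<in> glued d \<tau> \<sigma>"
    and "\<And>i y. i \<in> {1..d} \<Longrightarrow> y \<in> {0..1} \<Longrightarrow> F (i, 1, y) = F (\<tau> i, 0, y)"
    and "\<And>i x. i \<in> {1..d} \<Longrightarrow> x \<in> {0..1} \<Longrightarrow> F (i, x, 1) = F (\<sigma> i, x, 0)"
  shows "F p = F q"
  using assms(1) unfolding glued_def
proof (induction rule: rtrancl_induct)
  case (step q r)
  then have "(q, r) \<in> glue_sides d \<tau> \<sigma> \<or> (r, q) \<in> glue_sides d \<tau> \<sigma>" by auto
  then have "F q = F r" using assms(2,3) unfolding glue_sides_def by auto
  with step show ?case by simp
qed simp

lemma glued_refl: "(p, p) \<in> glued d \<tau> \<sigma>"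
  by (simp add: glued_def)

lemma glued_sym: "(p, q) \<in> glued d \<tau> \<sigma> \<Longrightarrow> (q, p) \<in> glued d \<tau> \<sigma>"
  unfolding glued_def by (metis sym_Un_converse sym_rtrancl symE)

lemma glued_trans: "(p, q) \<in> glued d \<tau> \<sigma> \<Longrightarrow> (q, r) \<in> glued d \<tau> \<sigma> \<Longrightarrow> (p, r) \<in> glued d \<tau> \<sigma>"
  unfolding glued_def by (rule rtrancl_trans)

lemma proj_eq_iff: "proj d \<tau> \<sigma> p = proj d \<tau> \<sigma> q \<longleftrightarrow> (p, q) \<in> glued d \<tau> \<sigma>"
  unfolding proj_def by (auto intro: glued_refl glued_sym glued_trans)

lemma proj_tau: "i \<in> {1..d} \<Longrightarrow> y \<in> {0..1} \<Longrightarrow> proj d \<tau> \<sigma> (i, 1, y) = proj d \<tau> \<sigma> (\<tau> i, 0, y)"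
  unfolding proj_eq_iff glued_def glue_sides_def by (rule r_into_rtrancl) auto

lemma proj_sigma: "i \<in> {1..d} \<Longrightarrow> x \<in> {0..1} \<Longrightarrow> proj d \<tau> \<sigma> (i, x, 1) = proj d \<tau> \<sigma> (\<sigma> i, x, 0)"
  unfolding proj_eq_iff glued_def glue_sides_def by (rule r_into_rtrancl) auto

text \<open>If the two permutations commute, every vertex determines a square label, so that there
  are at least as many vertices as squares and the Euler characteristic is nonnegative.\<close>

lemma genus_ge_2_not_commute:
  assumes tau: "\<tau> permutes {1..d}" and sigma: "\<sigma> permutes {1..d}" and "genus d \<tau> \<sigma> \<ge> 2"
  shows "\<tau> \<circ> \<sigma> \<noteq> \<sigma> \<circ> \<tau>"
proof
  assume "\<tau> \<circ> \<sigma> = \<sigma> \<circ> \<tau>"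
  then have comm: "\<tau> (\<sigma> i) = \<sigma> (\<tau> i)" for i by (metis comp_apply)
  \<comment> \<open>The label of the representative with both coordinates below 1. At the corner (1,
    1) both gluings are applied, and commutation makes their order irrelevant.\<close>
  define F :: "point \<Rightarrow> nat" where
    "F = (\<lambda>(i, x, y). (if x = 1 then \<tau> else id) ((if y = 1 then \<sigma> else id) i))"
  define G where "G v = F (SOME p. p \<in> v)" for v
  have G: "G (proj d \<tau> \<sigma> p) = F p" for p
  proof -
    have "p \<in> proj d \<tau> \<sigma> p" by (simp add: proj_def glued_refl)
    then have "(SOME q. q \<in> proj d \<tau> \<sigma> p) \<in> proj d \<tau> \<sigma> p" by (rule someI)
    then have "(p, SOME q. q \<in> proj d \<tau> \<sigma> p) \<in> glued d \<tau> \<sigma>" by (simp add: proj_def)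
    from glued_invariant[OF this, of F] show ?thesis by (auto simp: G_def F_def comm)
  qed
  have "i \<in> G ` vertices d \<tau> \<sigma>" if "i \<in> {1..d}" for i
  proof -
    have "G (proj d \<tau> \<sigma> (i, 0, 0)) = i" by (simp add: G F_def)
    moreover have "proj d \<tau> \<sigma> (i, 0, 0) \<in> vertices d \<tau> \<sigma>" using that by (auto simp: vertices_def)
    ultimately show ?thesis by (metis image_eqI)
  qed
  then have "{1..d} \<subseteq> G ` vertices d \<tau> \<sigma>" by blast
  then have "card {1..d} \<le> card (vertices d \<tau> \<sigma>)"
    by (rule surj_card_le[rotated]) (simp add: vertices_def)
  then have "euler_char d \<tau> \<sigma> \<ge> 0" by (simp add: euler_char_def)
  then show False using assms(3) by (simp add: genus_def)
qed

text \<open>For u < 0 the lower end is \<lceil>X\<rceil> - 1, so that a motion starting at an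
  integer enters the interval on the decreasing side. This matches the one-sided closed pieces
  required of straight lines.\<close>

lemma exists_cell: "\<exists>m::int. \<exists>\<epsilon>>0. \<forall>r\<in>{0..\<epsilon>}. of_int m \<le> X + r * u \<and> X + r * u \<le> of_int m + 1"
  for X u :: real
proof (cases "u \<ge> 0")
  case True
  \<comment> \<open>The summand 1 keeps the denominator positive when u = 0.\<close>
  define \<epsilon> where "\<epsilon> = (of_int \<lfloor>X\<rfloor> + 1 - X) / (u + 1)"
  have "\<epsilon> > 0" using True unfolding \<epsilon>_def by (intro divide_pos_pos) linarith+
  moreover have "of_int \<lfloor>X\<rfloor> \<le> X + r * u \<and> X + r * u \<le> of_int \<lfloor>X\<rfloor> + 1" if "r \<in> {0..\<epsilon>}" for r
  proof -
    have "r * u \<le> \<epsilon> * (u + 1)" using that True by (intro mult_mono) auto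
    also have "\<dots> = of_int \<lfloor>X\<rfloor> + 1 - X" using True by (simp add: \<epsilon>_def)
    finally show ?thesis using that True by (simp add: add_increasing2)
  qed
  ultimately show ?thesis by blast
next
  case False
  define \<epsilon> where "\<epsilon> = (X - (of_int \<lceil>X\<rceil> - 1)) / (- u)"
  have "\<epsilon> > 0" using False unfolding \<epsilon>_def by (intro divide_pos_pos) linarith+
  moreover have "of_int (\<lceil>X\<rceil> - 1) \<le> X + r * u \<and> X + r * u \<le> of_int (\<lceil>X\<rceil> - 1) + 1"
    if "r \<in> {0..\<epsilon>}" for r
  proof -
    have "r * (- u) \<le> \<epsilon> * (- u)" using that False by (intro mult_right_mono) auto
    also have "\<dots> = X - (of_int \<lceil>X\<rceil> - 1)" using False by (simp add: \<epsilon>_def)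
    finally have 1: "r * (- u) \<le> X - (of_int \<lceil>X\<rceil> - 1)" .
    have "r * u \<le> 0" using that False by (simp add: mult_nonneg_nonpos)
    with 1 show ?thesis by (simp only: of_int_diff) linarith
  qed
  ultimately show ?thesis by blast
qed

text \<open>Connectedness of the real line. The factors 1 and -1 are written out so that forward and
  backward steps are instances of one statement with a direction factor k.\<close>

lemma locally_constant_on_line:
  fixes P :: "real \<Rightarrow> bool"
  assumes "\<And>s. \<exists>\<epsilon>>0. \<forall>r\<in>{0..\<epsilon>}. P s = P (s + 1 * r)" "\<And>s. \<exists>\<epsilon>>0. \<forall>r\<in>{0..\<epsilon>}. P s = P (s + (-1) * r)"
  shows "P s = P t"
proof (rule connected_local_const[where f = P and A = UNIV and a = s and b = t])
  show "\<forall>a\<in>UNIV. eventually (\<lambda>b. P a = P b) (at a)"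
  proof
    fix a
    obtain \<epsilon> \<epsilon>' where "\<epsilon> > 0" "\<forall>r\<in>{0..\<epsilon>}. P a = P (a + r)" "\<epsilon>' > 0" "\<forall>r\<in>{0..\<epsilon>'}. P a = P (a - r)"
      using assms[of a] by auto
    then have "P a = P b" if "dist b a < min \<epsilon> \<epsilon>'" for b
      using that by (cases "b \<ge> a") (force simp: dist_real_def dest!: bspec[of _ _ "\<bar>b - a\<bar>"])+
    with \<open>\<epsilon> > 0\<close> \<open>\<epsilon>' > 0\<close> show "eventually (\<lambda>b. P a = P b) (at a)"
      unfolding eventually_at by (intro exI[of _ "min \<epsilon> \<epsilon>'"]) auto
  qed
qed auto

section \<open>The permutation cocycle of a line\<close>

locale square_tiled =
  fixes d :: nat and \<tau> \<sigma> :: "nat \<Rightarrow> nat" and \<theta> :: real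
  assumes tau: "\<tau> permutes {1..d}" and sigma: "\<sigma> permutes {1..d}" and slope: "tan \<theta> \<notin> \<rat>"
begin

abbreviation "\<alpha> \<equiv> tan \<theta>"
abbreviation "\<pi> \<equiv> proj d \<tau> \<sigma>"
abbreviation "flow \<equiv> linear_flow d \<tau> \<sigma> \<theta>"
abbreviation "straight \<equiv> straight_line d \<tau> \<sigma> \<theta>"

lemma cos_nz: "cos \<theta> \<noteq> 0"
  using slope by (auto simp: tan_def)

lemma sin_eq: "sin \<theta> = \<alpha> * cos \<theta>"
  using cos_nz by (simp add: tan_def)

lemma sin_nz: "sin \<theta> \<noteq> 0"
  using slope by (auto simp: tan_def)

definition sg :: "int \<Rightarrow> nat \<Rightarrow> nat" where
  "sg = int_iter (\<lambda>_. \<sigma>)"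

definition crossing :: "int \<Rightarrow> nat \<Rightarrow> nat" where
  "crossing n = sg (- n) \<circ> \<tau> \<circ> sg n"

definition hol :: "real \<Rightarrow> int \<Rightarrow> nat \<Rightarrow> nat" where
  "hol b = int_iter (\<lambda>k. crossing \<lfloor>b + \<alpha> * of_int k\<rfloor>)"

definition label :: "real \<Rightarrow> int \<Rightarrow> int \<Rightarrow> nat \<Rightarrow> nat" where
  "label b m n = sg n \<circ> hol b m"

text \<open>Parametrised by the horizontal coordinate X. The floors select the representative in the
  half-open square; closed cells are recovered in \<open>leaf_cell\<close>.\<close>

definition leaf :: "real \<Rightarrow> nat \<Rightarrow> real \<Rightarrow> point set" where
  "leaf b i X = \<pi> (label b \<lfloor>X\<rfloor> \<lfloor>b + \<alpha> * X\<rfloor> i, frac X, frac (b + \<alpha> * X))"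

definition generic :: "real \<Rightarrow> bool" where
  "generic b \<longleftrightarrow> (\<forall>m::int. b + \<alpha> * of_int m \<notin> \<int>)"

lemma sg_permutes: "sg n permutes {1..d}"
  unfolding sg_def by (intro int_iter_permutes sigma)

lemma sg_add: "sg (m + n) = sg m \<circ> sg n"
  unfolding sg_def by (intro int_iter_add permutes_bij[OF sigma])

lemma sg_0 [simp]: "sg 0 = id" and sg_1: "sg 1 = \<sigma>"
  unfolding sg_def using int_iter_succ[of "\<lambda>_. \<sigma>" 0] permutes_bij[OF sigma] by simp_all

lemma sg_minus: "sg n \<circ> sg (- n) = id" "sg (- n) \<circ> sg n = id"
  using sg_add[of n "- n"] sg_add[of "- n" n] by simp_all

lemma crossing_permutes: "crossing n permutes {1..d}"
  unfolding crossing_def using sg_permutes tau by (intro permutes_compose) auto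

lemma crossing_bij: "bij (crossing n)"
  using crossing_permutes by (rule permutes_bij)

lemma crossing_add: "crossing (n + p) = sg (- p) \<circ> crossing n \<circ> sg p"
  unfolding crossing_def minus_add sg_add[of n] add.commute[of "- n"] sg_add[of "- p"] 
  by (simp add: comp_assoc)

text \<open>Conjugation with \<sigma>^n turns the two crossings into \<sigma>^-1 \<tau> \<sigma> and
  \<tau>, whatever n is.\<close>

lemma crossing_succ_neq:
  assumes "\<tau> \<circ> \<sigma> \<noteq> \<sigma> \<circ> \<tau>"
  shows "crossing (n + 1) \<noteq> crossing n"
proof
  assume *: "crossing (n + 1) = crossing n"
  have "sg 1 \<circ> (sg n \<circ> crossing (n + 1) \<circ> sg (- n)) = sg 1 \<circ> (sg n \<circ> (sg (- n) \<circ> (sg (-1) \<circ> \<tau> \<circ> sg 1) \<circ> sg n) \<circ> sg (- n))"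
    using crossing_add[of 1 n] unfolding crossing_def[of 1] by (simp add: add.commute)
  also have "\<dots> = (sg 1 \<circ> ((sg n \<circ> sg (- n)) \<circ> sg (-1))) \<circ> \<tau> \<circ> (sg 1 \<circ> (sg n \<circ> sg (- n)))"
    by (simp only: comp_assoc)
  also have "\<dots> = \<tau> \<circ> \<sigma>"
    using sg_minus(1)[of 1] by (simp add: sg_minus sg_1)
  finally have 1: "sg 1 \<circ> (sg n \<circ> crossing (n + 1) \<circ> sg (- n)) = \<tau> \<circ> \<sigma>" .
  have "sg 1 \<circ> (sg n \<circ> crossing n \<circ> sg (- n)) = sg 1 \<circ> ((sg n \<circ> sg (- n)) \<circ> \<tau> \<circ> (sg n \<circ> sg (- n)))"
    by (simp only: crossing_def comp_assoc)
  also have "\<dots> = \<sigma> \<circ> \<tau>" by (simp add: sg_minus sg_1)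
  finally show False using 1 * assms by simp
qed

lemma hol_permutes: "hol b m permutes {1..d}"
  unfolding hol_def by (intro int_iter_permutes crossing_permutes)

lemma hol_0 [simp]: "hol b 0 = id"
  by (simp add: hol_def)

lemma hol_succ: "hol b (m + 1) = crossing \<lfloor>b + \<alpha> * of_int (m + 1)\<rfloor> \<circ> hol b m"
  unfolding hol_def by (rule int_iter_succ) (rule crossing_bij)

lemma label_permutes: "label b m n permutes {1..d}"
  unfolding label_def by (intro permutes_compose hol_permutes sg_permutes)

lemma label_in: "i \<in> {1..d} \<Longrightarrow> label b m n i \<in> {1..d}"
  using permutes_in_image[OF label_permutes] by blast

lemma label_00 [simp]: "label b 0 0 i = i"
  by (simp add: label_def)

lemma label_succ_row: "label b m (n + 1) i = \<sigma> (label b m n i)"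
  using sg_add[of 1 n] by (simp add: label_def sg_1 add.commute)

text \<open>In the row that the line occupies at x = m + 1, the powers of \<sigma> in
  \<open>crossing\<close> cancel against those in \<open>label\<close>, and a bare \<tau>
  remains.\<close>

lemma label_succ_column:
  assumes "n = \<lfloor>b + \<alpha> * of_int (m + 1)\<rfloor>"
  shows "label b (m + 1) n i = \<tau> (label b m n i)"
proof -
  have "label b (m + 1) n = (sg n \<circ> sg (- n)) \<circ> \<tau> \<circ> (sg n \<circ> hol b m)"
    unfolding label_def hol_succ assms[symmetric] crossing_def by (simp only: comp_assoc)
  then show ?thesis by (simp add: sg_minus label_def)
qed

text \<open>Floors assign a point on the far side of a cell to the next cell, whereas
  \<open>straight_line\<close> asks for pieces in one closed square. On such a side the gluing by
  \<tau> or \<sigma> is exactly the change of label, so both descriptions give the same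
  point.\<close>

lemma leaf_cell:
  assumes "of_int m \<le> X" "X \<le> of_int m + 1" "of_int n \<le> b + \<alpha> * X" "b + \<alpha> * X \<le> of_int n + 1"
    and not_vertex: "\<not> (X \<in> \<int> \<and> b + \<alpha> * X \<in> \<int>)" and i: "i \<in> {1..d}"
  shows "leaf b i X = \<pi> (label b m n i, X - of_int m, b + \<alpha> * X - of_int n)"
proof -
  let ?Y = "b + \<alpha> * X"
  consider "X < of_int m + 1" "?Y < of_int n + 1" | "X = of_int m + 1" | "?Y = of_int n + 1"
    using assms by linarith
  then show ?thesis
  proof cases
    case 1
    then have "\<lfloor>X\<rfloor> = m" "\<lfloor>?Y\<rfloor> = n" using assms by (auto simp: floor_eq_iff)
    then show ?thesis by (simp add: leaf_def frac_def)
  next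
    case 2
    then have "X \<in> \<int>" by simp
    then have "?Y \<notin> \<int>" using not_vertex by simp
    then have "?Y \<noteq> of_int n + 1" by (metis Ints_of_int of_int_1 of_int_add)
    then have n: "\<lfloor>?Y\<rfloor> = n" using assms by (auto simp: floor_eq_iff)
    have m: "\<lfloor>X\<rfloor> = m + 1" using 2 by simp
    have "label b (m + 1) n i = \<tau> (label b m n i)"
      by (rule label_succ_column) (use n 2 in simp)
    then have "leaf b i X = \<pi> (\<tau> (label b m n i), 0, ?Y - of_int n)"
      using n m 2 by (simp add: leaf_def frac_def)
    also have "\<dots> = \<pi> (label b m n i, 1, ?Y - of_int n)"
      using assms label_in[OF i] by (intro proj_tau[symmetric]) auto
    finally show ?thesis using 2 by simp
  next
    case 3
    then have "?Y \<in> \<int>" by simp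
    then have "X \<notin> \<int>" using not_vertex by simp
    then have "X \<noteq> of_int m + 1" by (metis Ints_of_int of_int_1 of_int_add)
    then have m: "\<lfloor>X\<rfloor> = m" using assms by (auto simp: floor_eq_iff)
    have n: "\<lfloor>?Y\<rfloor> = n + 1" using 3 by simp
    have "leaf b i X = \<pi> (\<sigma> (label b m n i), X - of_int m, 0)"
      using n m 3 by (simp add: leaf_def frac_def label_succ_row)
    also have "\<dots> = \<pi> (label b m n i, X - of_int m, 1)"
      using assms label_in[OF i] by (intro proj_sigma[symmetric]) auto
    finally show ?thesis using 3 by simp
  qed
qed

section \<open>Points of the surface modulo the integer lattice\<close>

lemma proj_frac:
  assumes "\<pi> (i, x, y) = \<pi> (j, x', y')"
  shows "frac x = frac x'" "frac y = frac y'"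
  using glued_invariant[of "(i, x, y)" "(j, x', y')" d \<tau> \<sigma> "\<lambda>(i, x, y). (frac x, frac y)"] assms
  by (auto simp: proj_eq_iff)

lemma vertex_frac:
  assumes "\<pi> (i, x, y) \<in> vertices d \<tau> \<sigma>"
  shows "frac x = 0" "frac y = 0"
proof -
  obtain j x' y' where "\<pi> (i, x, y) = \<pi> (j, x', y')" "x' \<in> {0, 1}" "y' \<in> {0, 1}"
    using assms by (auto simp: vertices_def)
  then show "frac x = 0" "frac y = 0" using proj_frac by (metis frac_1_eq add_0 frac_of_int insertE of_int_0 singletonD)+
qed

lemma corner_vertex:
  assumes "(i, x, y) \<in> squares d" "frac x = 0" "frac y = 0"
  shows "\<pi> (i, x, y) \<in> vertices d \<tau> \<sigma>"
proof -
  have "x \<in> {0, 1}" "y \<in> {0, 1}"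
    using assms by (auto simp: squares_def frac_eq_0_iff elim!: Ints_cases)
  with assms show ?thesis unfolding vertices_def squares_def by blast
qed

text \<open>The direction of motion singles out one of the two representatives of a point on an edge.\<close>

lemma proj_inj_direction:
  assumes "(i, x, y) \<in> squares d" "(i', x', y') \<in> squares d"
    and "(i, x + u, y + v) \<in> squares d" "(i', x' + u, y' + v) \<in> squares d"
    and uv: "u \<noteq> 0" "v \<noteq> 0"
    and eq: "\<pi> (i, x, y) = \<pi> (i', x', y')" and nv: "\<pi> (i, x, y) \<notin> vertices d \<tau> \<sigma>"
  shows "(i, x, y) = (i', x', y')"
proof -
  \<comment> \<open>A point on a side is moved to the square that the direction (u, v) enters, and
    corners are collapsed. Since the displaced points stay in their squares, \<open>F\<close> fixes
    the two given points.\<close>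
  define F :: "point \<Rightarrow> point" where "F = (\<lambda>(i, x, y).
     if x \<in> {0, 1} \<and> y \<in> {0, 1} then (0, 0, 0)
     else if x = 1 \<and> u > 0 then (\<tau> i, 0, y) else if x = 0 \<and> u < 0 then (inv \<tau> i, 1, y)
     else if y = 1 \<and> v > 0 then (\<sigma> i, x, 0) else if y = 0 \<and> v < 0 then (inv \<sigma> i, x, 1)
     else (i, x, y))"
  have "F (i, x, y) = F (i', x', y')"
  proof (rule glued_invariant[of _ _ d \<tau> \<sigma> F])
    show "((i, x, y), (i', x', y')) \<in> glued d \<tau> \<sigma>" using eq by (simp add: proj_eq_iff)
  qed (use uv in \<open>auto simp: F_def permutes_inverses[OF tau] permutes_inverses[OF sigma]\<close>)
  moreover have corner: "\<not> (x \<in> {0, 1} \<and> y \<in> {0, 1})"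
    using corner_vertex[of i x y] assms by auto
  moreover have "\<not> (x' \<in> {0, 1} \<and> y' \<in> {0, 1})"
    using corner_vertex[of i' x' y'] assms by auto
  ultimately show ?thesis
    using assms(1-4) uv unfolding F_def squares_def by (auto split: if_splits)
qed

lemma generic_not_lattice: "generic b \<Longrightarrow> \<not> (X \<in> \<int> \<and> b + \<alpha> * X \<in> \<int>)"
  by (metis Ints_cases generic_def)

section \<open>Existence and uniqueness of straight lines\<close>

lemma leaf_local:
  assumes b: "generic b" and i: "i \<in> {1..d}"
  shows "\<exists>\<epsilon>>0. \<exists>j z. \<forall>r\<in>{0..\<epsilon>}. (j, z + r *\<^sub>R (k *\<^sub>R unit_vector \<theta>)) \<in> squares d \<and>
      leaf b i (X + r * (k * cos \<theta>)) = \<pi> (j, z + r *\<^sub>R (k *\<^sub>R unit_vector \<theta>))"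
proof -
  obtain m \<epsilon>1 where m: "\<epsilon>1 > 0" "\<And>r. r \<in> {0..\<epsilon>1} \<Longrightarrow>
      of_int m \<le> X + r * (k * cos \<theta>) \<and> X + r * (k * cos \<theta>) \<le> of_int m + 1"
    using exists_cell[of X "k * cos \<theta>"] by blast
  let ?Y = "b + \<alpha> * X"
  obtain n \<epsilon>2 where n: "\<epsilon>2 > 0" "\<And>r. r \<in> {0..\<epsilon>2} \<Longrightarrow>
      of_int n \<le> ?Y + r * (k * sin \<theta>) \<and> ?Y + r * (k * sin \<theta>) \<le> of_int n + 1"
    using exists_cell[of ?Y "k * sin \<theta>"] by blast
  have Y: "b + \<alpha> * (X + r * (k * cos \<theta>)) = ?Y + r * (k * sin \<theta>)" for r
    by (simp add: sin_eq algebra_simps)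
  have nv: "\<not> (X \<in> \<int> \<and> b + \<alpha> * X \<in> \<int>)" for X by (rule generic_not_lattice[OF b])
  show ?thesis
  proof (intro exI[of _ "min \<epsilon>1 \<epsilon>2"] conjI exI[of _ "label b m n i"] exI[of _ "(X - of_int m, ?Y - of_int n)"] ballI)
    fix r assume "r \<in> {0..min \<epsilon>1 \<epsilon>2}"
    then have r: "of_int m \<le> X + r * (k * cos \<theta>)" "X + r * (k * cos \<theta>) \<le> of_int m + 1"
      "of_int n \<le> ?Y + r * (k * sin \<theta>)" "?Y + r * (k * sin \<theta>) \<le> of_int n + 1"
      using m n by auto
    show "(label b m n i, (X - of_int m, ?Y - of_int n) + r *\<^sub>R (k *\<^sub>R unit_vector \<theta>)) \<in> squares d"
      using r label_in[OF i] by (simp add: squares_def unit_vector_def algebra_simps)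
    show "leaf b i (X + r * (k * cos \<theta>)) =
        \<pi> (label b m n i, (X - of_int m, ?Y - of_int n) + r *\<^sub>R (k *\<^sub>R unit_vector \<theta>))"
      using leaf_cell[of m "X + r * (k * cos \<theta>)" n b i, unfolded Y, OF r nv[of "X + r * (k * cos \<theta>)", unfolded Y] i]
      by (simp add: unit_vector_def algebra_simps)
  qed (use m n in auto)
qed

lemma leaf_straight:
  assumes b: "generic b" and i: "i \<in> {1..d}"
  shows "straight (\<lambda>t. leaf b i (x + t * cos \<theta>))"
  unfolding straight_line_def
proof (intro allI conjI)
  fix s
  have nv: "\<not> (X \<in> \<int> \<and> b + \<alpha> * X \<in> \<int>)" for X by (rule generic_not_lattice[OF b])
  show "leaf b i (x + s * cos \<theta>) \<notin> vertices d \<tau> \<sigma>"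
  proof
    assume "leaf b i (x + s * cos \<theta>) \<in> vertices d \<tau> \<sigma>"
    from vertex_frac[OF this[unfolded leaf_def]] nv[of "x + s * cos \<theta>"] show False
      by (simp add: frac_eq_0_iff)
  qed
  show "\<exists>\<epsilon>>0. \<exists>j z. \<forall>r\<in>{0..\<epsilon>}. (j, z + r *\<^sub>R unit_vector \<theta>) \<in> squares d \<and>
        leaf b i (x + (s + r) * cos \<theta>) = \<pi> (j, z + r *\<^sub>R unit_vector \<theta>)"
    using leaf_local[OF b i, of 1 "x + s * cos \<theta>"] by (simp add: algebra_simps)
  show "\<exists>\<epsilon>>0. \<exists>j z. \<forall>r\<in>{0..\<epsilon>}. (j, z - r *\<^sub>R unit_vector \<theta>) \<in> squares d \<and>
        leaf b i (x + (s - r) * cos \<theta>) = \<pi> (j, z - r *\<^sub>R unit_vector \<theta>)"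
    using leaf_local[OF b i, of "-1" "x + s * cos \<theta>"] by (simp add: algebra_simps)
qed

text \<open>Both implications come from \<open>proj_inj_direction\<close>, with the displacement and
  with its opposite. An equivalence is needed because agreement has to be locally constant in time,
  not merely preserved.\<close>

lemma straight_local_agree:
  assumes straight: "straight \<gamma>" "straight \<gamma>'" and k: "k \<noteq> 0"
    and 1: "\<forall>r\<in>{0..\<epsilon>}. (i, z + r *\<^sub>R (k *\<^sub>R unit_vector \<theta>)) \<in> squares d \<and>
      \<gamma> (s + k * r) = \<pi> (i, z + r *\<^sub>R (k *\<^sub>R unit_vector \<theta>))"
    and 2: "\<forall>r\<in>{0..\<epsilon>'}. (i', z' + r *\<^sub>R (k *\<^sub>R unit_vector \<theta>)) \<in> squares d \<and>
      \<gamma>' (s + k * r) = \<pi> (i', z' + r *\<^sub>R (k *\<^sub>R unit_vector \<theta>))"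
    and r: "0 \<le> r" "r \<le> \<epsilon>" "r \<le> \<epsilon>'"
  shows "\<gamma> s = \<gamma>' s \<longleftrightarrow> \<gamma> (s + k * r) = \<gamma>' (s + k * r)"
proof (cases "r = 0")
  case False
  obtain x y x' y' where z: "z = (x, y)" "z' = (x', y')" by (metis surj_pair)
  define u v where "u = r * (k * cos \<theta>)" and "v = r * (k * sin \<theta>)"
  have uv: "u \<noteq> 0" "v \<noteq> 0" using False k cos_nz sin_nz by (auto simp: u_def v_def)
  have nv: "\<gamma> t \<notin> vertices d \<tau> \<sigma>" for t using straight(1) by (auto simp: straight_line_def)
  have at0: "(i, x, y) \<in> squares d" "\<gamma> s = \<pi> (i, x, y)" "(i', x', y') \<in> squares d" "\<gamma>' s = \<pi> (i', x', y')"
    using bspec[OF 1, of 0] bspec[OF 2, of 0] r by (auto simp: z)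
  have at1: "(i, x + u, y + v) \<in> squares d" "\<gamma> (s + k * r) = \<pi> (i, x + u, y + v)"
    "(i', x' + u, y' + v) \<in> squares d" "\<gamma>' (s + k * r) = \<pi> (i', x' + u, y' + v)"
    using bspec[OF 1, of r] bspec[OF 2, of r] r by (auto simp: z unit_vector_def u_def v_def)
  show ?thesis
  proof
    assume "\<gamma> s = \<gamma>' s"
    then have "(i, x, y) = (i', x', y')"
      using at0 at1 nv[of s] uv by (intro proj_inj_direction[of i x y i' x' y' u v]) auto
    then show "\<gamma> (s + k * r) = \<gamma>' (s + k * r)" using at1 by simp
  next
    assume "\<gamma> (s + k * r) = \<gamma>' (s + k * r)"
    then have "(i, x + u, y + v) = (i', x' + u, y' + v)"
      using at0 at1 nv[of "s + k * r"] uv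
      by (intro proj_inj_direction[of i "x + u" "y + v" i' "x' + u" "y' + v" "- u" "- v"]) auto
    then show "\<gamma> s = \<gamma>' s" using at0 by simp
  qed
qed simp

lemma straight_forward:
  assumes "straight \<gamma>"
  obtains \<epsilon> i z where "\<epsilon> > 0" "\<forall>r\<in>{0..\<epsilon>}. (i, z + r *\<^sub>R (1 *\<^sub>R unit_vector \<theta>)) \<in> squares d \<and>
      \<gamma> (s + 1 * r) = \<pi> (i, z + r *\<^sub>R (1 *\<^sub>R unit_vector \<theta>))"
proof -
  obtain \<epsilon> i z where "\<epsilon> > 0" "\<forall>r\<in>{0..\<epsilon>}. (i, z + r *\<^sub>R unit_vector \<theta>) \<in> squares d \<and>
        \<gamma> (s + r) = \<pi> (i, z + r *\<^sub>R unit_vector \<theta>)"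
    using assms unfolding straight_line_def by metis
  then show ?thesis by (intro that[of \<epsilon> i z]) auto
qed

lemma straight_backward:
  assumes "straight \<gamma>"
  obtains \<epsilon> i z where "\<epsilon> > 0" "\<forall>r\<in>{0..\<epsilon>}. (i, z + r *\<^sub>R ((-1) *\<^sub>R unit_vector \<theta>)) \<in> squares d \<and>
      \<gamma> (s + (-1) * r) = \<pi> (i, z + r *\<^sub>R ((-1) *\<^sub>R unit_vector \<theta>))"
proof -
  obtain \<epsilon> i z where "\<epsilon> > 0" "\<forall>r\<in>{0..\<epsilon>}. (i, z - r *\<^sub>R unit_vector \<theta>) \<in> squares d \<and>
        \<gamma> (s - r) = \<pi> (i, z - r *\<^sub>R unit_vector \<theta>)"
    using assms unfolding straight_line_def by metis
  then show ?thesis by (intro that[of \<epsilon> i z]) auto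
qed

text \<open>Agreement of two lines is a locally constant property of time, hence constant. This
  makes the definite description in \<open>linear_flow\<close> meaningful.\<close>

lemma straight_unique:
  assumes straight: "straight \<gamma>" "straight \<gamma>'" and "\<gamma> s = \<gamma>' s"
  shows "\<gamma> t = \<gamma>' t"
proof -
  have "\<exists>\<epsilon>>0. \<forall>r\<in>{0..\<epsilon>}. (\<gamma> s = \<gamma>' s) = (\<gamma> (s + 1 * r) = \<gamma>' (s + 1 * r))" for s
  proof -
    obtain \<epsilon> i z \<epsilon>' i' z' where
      1: "\<epsilon> > 0" "\<forall>r\<in>{0..\<epsilon>}. (i, z + r *\<^sub>R (1 *\<^sub>R unit_vector \<theta>)) \<in> squares d \<and>
        \<gamma> (s + 1 * r) = \<pi> (i, z + r *\<^sub>R (1 *\<^sub>R unit_vector \<theta>))" and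
      2: "\<epsilon>' > 0" "\<forall>r\<in>{0..\<epsilon>'}. (i', z' + r *\<^sub>R (1 *\<^sub>R unit_vector \<theta>)) \<in> squares d \<and>
        \<gamma>' (s + 1 * r) = \<pi> (i', z' + r *\<^sub>R (1 *\<^sub>R unit_vector \<theta>))"
      using straight_forward[OF straight(1), of s] straight_forward[OF straight(2), of s] by metis
    show ?thesis
      using straight_local_agree[OF straight _ 1(2) 2(2)] 1(1) 2(1)
      by (intro exI[of _ "min \<epsilon> \<epsilon>'"]) auto
  qed
  moreover have "\<exists>\<epsilon>>0. \<forall>r\<in>{0..\<epsilon>}. (\<gamma> s = \<gamma>' s) = (\<gamma> (s + (-1) * r) = \<gamma>' (s + (-1) * r))" for s
  proof -
    obtain \<epsilon> i z \<epsilon>' i' z' where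
      1: "\<epsilon> > 0" "\<forall>r\<in>{0..\<epsilon>}. (i, z + r *\<^sub>R ((-1) *\<^sub>R unit_vector \<theta>)) \<in> squares d \<and>
        \<gamma> (s + (-1) * r) = \<pi> (i, z + r *\<^sub>R ((-1) *\<^sub>R unit_vector \<theta>))" and
      2: "\<epsilon>' > 0" "\<forall>r\<in>{0..\<epsilon>'}. (i', z' + r *\<^sub>R ((-1) *\<^sub>R unit_vector \<theta>)) \<in> squares d \<and>
        \<gamma>' (s + (-1) * r) = \<pi> (i', z' + r *\<^sub>R ((-1) *\<^sub>R unit_vector \<theta>))"
      using straight_backward[OF straight(1), of s] straight_backward[OF straight(2), of s] by metis
    show ?thesis
      using straight_local_agree[OF straight _ 1(2) 2(2)] 1(1) 2(1)
      by (intro exI[of _ "min \<epsilon> \<epsilon>'"]) auto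
  qed
  ultimately have "(\<gamma> s = \<gamma>' s) = (\<gamma> t = \<gamma>' t)"
    by (rule locally_constant_on_line)
  with assms show ?thesis by simp
qed

section \<open>The flow as a group action\<close>

lemma flow_straight:
  assumes "straight \<gamma>"
  shows "flow t (\<gamma> 0) = \<gamma> t"
proof -
  have "\<gamma>' = \<gamma>" if "straight \<gamma>' \<and> \<gamma>' 0 = \<gamma> 0" for \<gamma>'
    using straight_unique[of \<gamma>' \<gamma> 0] that assms by (intro ext) auto
  then have "(THE \<gamma>'. straight \<gamma>' \<and> \<gamma>' 0 = \<gamma> 0) = \<gamma>"
    using assms by (intro the_equality) auto
  moreover have "\<exists>\<gamma>'. straight \<gamma>' \<and> \<gamma>' 0 = \<gamma> 0" using assms by blast
  ultimately show ?thesis unfolding linear_flow_def by (subst if_P) auto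
qed

lemma flow_not_straight: "\<nexists>\<gamma>. straight \<gamma> \<and> \<gamma> 0 = p \<Longrightarrow> flow t p = p"
  unfolding linear_flow_def by (rule if_not_P)

lemma straight_shift:
  assumes "straight \<gamma>"
  shows "straight (\<lambda>t. \<gamma> (t + a))"
  unfolding straight_line_def
proof
  fix s
  show "\<gamma> (s + a) \<notin> vertices d \<tau> \<sigma> \<and>
     (\<exists>\<epsilon>>0. \<exists>i z. \<forall>r\<in>{0..\<epsilon>}. (i, z + r *\<^sub>R unit_vector \<theta>) \<in> squares d \<and>
        \<gamma> (s + r + a) = \<pi> (i, z + r *\<^sub>R unit_vector \<theta>)) \<and>
     (\<exists>\<epsilon>>0. \<exists>i z. \<forall>r\<in>{0..\<epsilon>}. (i, z - r *\<^sub>R unit_vector \<theta>) \<in> squares d \<and>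
        \<gamma> (s - r + a) = \<pi> (i, z - r *\<^sub>R unit_vector \<theta>))"
    using assms[unfolded straight_line_def, rule_format, of "s + a"] by (simp add: algebra_simps)
qed

lemma flow_add: "flow (s + t) p = flow s (flow t p)"
proof (cases "\<exists>\<gamma>. straight \<gamma> \<and> \<gamma> 0 = p")
  case True
  then obtain \<gamma> where \<gamma>: "straight \<gamma>" "\<gamma> 0 = p" by blast
  have "flow s (\<gamma> t) = \<gamma> (s + t)"
    using flow_straight[OF straight_shift[OF \<gamma>(1), of t], of s] by simp
  with flow_straight[OF \<gamma>(1)] \<gamma>(2) show ?thesis by simp
next
  case False
  show ?thesis by (simp only: flow_not_straight[OF False])
qed

lemma flow_0: "flow 0 p = p"
proof (cases "\<exists>\<gamma>. straight \<gamma> \<and> \<gamma> 0 = p")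
  case True
  then show ?thesis using flow_straight[of _ 0] by auto
next
  case False
  then show ?thesis by (rule flow_not_straight)
qed

text \<open>A step inside one square moves the coordinates by the expected amount, and a change of
  representative alters them by integers. Since the line is arbitrary, this can exclude lines
  through nongeneric points, for which no formula is available.\<close>

lemma straight_frac:
  assumes straight: "straight \<gamma>" and "\<gamma> 0 = \<pi> (i, x, y)"
    and "\<gamma> t = \<pi> (j, x', y')"
  shows "x' - (x + t * cos \<theta>) \<in> \<int> \<and> y' - (y + t * sin \<theta>) \<in> \<int>"
proof -
  define P where "P t \<longleftrightarrow> (\<forall>j x' y'. \<gamma> t = \<pi> (j, x', y') \<longrightarrow>
    x' - (x + t * cos \<theta>) \<in> \<int> \<and> y' - (y + t * sin \<theta>) \<in> \<int>)" for t
  have frac_int: "a - b \<in> \<int>" if "frac a = frac b" for a b :: real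
  proof -
    have "a - b = of_int (\<lfloor>a\<rfloor> - \<lfloor>b\<rfloor>)" using that by (simp add: frac_def)
    then show ?thesis by (metis Ints_of_int)
  qed
  have P: "P t \<longleftrightarrow> x' - (x + t * cos \<theta>) \<in> \<int> \<and> y' - (y + t * sin \<theta>) \<in> \<int>"
    if "\<gamma> t = \<pi> (j, x', y')" for t j x' y'
  proof (intro iffI)
    assume *: "x' - (x + t * cos \<theta>) \<in> \<int> \<and> y' - (y + t * sin \<theta>) \<in> \<int>"
    show "P t" unfolding P_def
    proof (intro allI impI)
      fix k x'' y'' assume "\<gamma> t = \<pi> (k, x'', y'')"
      then have "x'' - x' \<in> \<int>" "y'' - y' \<in> \<int>"
        using that by (metis proj_frac frac_int)+
      with * have "x'' - x' + (x' - (x + t * cos \<theta>)) \<in> \<int>" "y'' - y' + (y' - (y + t * sin \<theta>)) \<in> \<int>"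
        by (meson Ints_add)+
      then show "x'' - (x + t * cos \<theta>) \<in> \<int> \<and> y'' - (y + t * sin \<theta>) \<in> \<int>"
        by (simp add: algebra_simps)
    qed
  qed (use that in \<open>auto simp: P_def\<close>)
  have local: "P s = P (s + k * r)" if
    "\<forall>r\<in>{0..\<epsilon>}. (i, z + r *\<^sub>R (k *\<^sub>R unit_vector \<theta>)) \<in> squares d \<and>
      \<gamma> (s + k * r) = \<pi> (i, z + r *\<^sub>R (k *\<^sub>R unit_vector \<theta>))" "r \<in> {0..\<epsilon>}" for s k r \<epsilon> i z
  proof -
    obtain a b where z: "z = (a, b)" by (metis surj_pair)
    have "\<gamma> s = \<pi> (i, a, b)" "\<gamma> (s + k * r) = \<pi> (i, a + r * (k * cos \<theta>), b + r * (k * sin \<theta>))"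
      using bspec[OF that(1), of 0] bspec[OF that(1), of r] that(2) by (auto simp: z unit_vector_def)
    then show ?thesis by (simp add: P algebra_simps)
  qed
  have "P 0 = P t"
  proof (rule locally_constant_on_line)
    show "\<exists>\<epsilon>>0. \<forall>r\<in>{0..\<epsilon>}. P s = P (s + 1 * r)" for s
      using straight_forward[OF straight, of s] local[of _ _ _ 1 s] by metis
    show "\<exists>\<epsilon>>0. \<forall>r\<in>{0..\<epsilon>}. P s = P (s + (-1) * r)" for s
      using straight_backward[OF straight, of s] local[of _ _ _ "-1" s] by metis
  qed
  moreover have "P 0" using assms(2) by (simp add: P)
  ultimately show ?thesis using assms(3) by (simp add: P)
qed

lemma flow_not_generic:
  assumes "\<not> generic (y - \<alpha> * x)"
  shows "flow t (\<pi> (i, x, y)) = \<pi> (i, x, y)"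
proof (rule flow_not_straight, rule notI, elim exE conjE)
  fix \<gamma> assume \<gamma>: "straight \<gamma>" "\<gamma> 0 = \<pi> (i, x, y)"
  obtain m :: int where m: "y - \<alpha> * x + \<alpha> * of_int m \<in> \<int>" using assms by (auto simp: generic_def)
  \<comment> \<open>The time at which the abscissa is m and the height is an integer: a straight
    line would then be at a vertex.\<close>
  define t where "t = (of_int m - x) / cos \<theta>"
  obtain \<epsilon> j z where z: "\<epsilon> > 0" "\<forall>r\<in>{0..\<epsilon>}. (j, z + r *\<^sub>R (1 *\<^sub>R unit_vector \<theta>)) \<in> squares d \<and>
      \<gamma> (t + 1 * r) = \<pi> (j, z + r *\<^sub>R (1 *\<^sub>R unit_vector \<theta>))"
    using straight_forward[OF \<gamma>(1), of t] by metis
  obtain x' y' where xy: "z = (x', y')" by (metis surj_pair)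
  have at: "(j, x', y') \<in> squares d" "\<gamma> t = \<pi> (j, x', y')"
    using bspec[OF z(2), of 0] z(1) xy by auto
  have "x + t * cos \<theta> = of_int m" "y + t * sin \<theta> = y - \<alpha> * x + \<alpha> * of_int m"
    using cos_nz by (auto simp: t_def sin_eq field_simps)
  with straight_frac[OF \<gamma> at(2)] m have "x' - of_int m + of_int m \<in> \<int>"
    "y' - (y - \<alpha> * x + \<alpha> * of_int m) + (y - \<alpha> * x + \<alpha> * of_int m) \<in> \<int>"
    by (metis Ints_add Ints_of_int)+
  then have "x' \<in> \<int>" "y' \<in> \<int>" by simp_all
  then have "\<gamma> t \<in> vertices d \<tau> \<sigma>" using corner_vertex[OF at(1)] at(2) by simp
  with \<gamma>(1) show False by (auto simp: straight_line_def)
qed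

lemma flow_generic:
  assumes sq: "(i, x, y) \<in> squares d" and g: "generic (y - \<alpha> * x)"
  shows "flow t (\<pi> (i, x, y)) = leaf (y - \<alpha> * x) i (x + t * cos \<theta>)"
proof -
  have i: "i \<in> {1..d}" using sq by (simp add: squares_def)
  have "leaf (y - \<alpha> * x) i x = \<pi> (i, x, y)"
    using leaf_cell[of 0 x 0 "y - \<alpha> * x" i] generic_not_lattice[OF g, of x] sq
    by (simp add: squares_def)
  then show ?thesis using flow_straight[OF leaf_straight[OF g i, of x], of t] by simp
qed

end

section \<open>Area\<close>

lemma borel_measurable_frac [measurable]: "(frac :: real \<Rightarrow> real) \<in> borel_measurable borel"
  unfolding frac_def[abs_def] by measurable

lemma borel_measurable_real_fst [measurable]: "(fst :: real \<times> real \<Rightarrow> real) \<in> borel_measurable borel"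
  and borel_measurable_real_snd [measurable]: "(snd :: real \<times> real \<Rightarrow> real) \<in> borel_measurable borel"
  by (auto intro!: borel_measurable_continuous_onI continuous_intros)

lemma borel_section:
  assumes "f \<in> borel_measurable borel" "B \<in> sets borel" "S \<in> sets borel"
  shows "{z \<in> S. f z \<in> B} \<in> sets borel"
proof -
  have "{z \<in> S. f z \<in> B} = S \<inter> f -` B" by auto
  with assms show ?thesis using measurable_sets_borel[of f borel B] by auto
qed

abbreviation unit_square :: "(real \<times> real) set" where
  "unit_square \<equiv> {0..1} \<times> {0..1}"

lemma unit_square_borel [measurable]: "unit_square \<in> sets borel"
  by (intro borel_closed closed_Times) auto

lemma emeasure_lborel_vimage_plus:
  fixes c :: "'a::euclidean_space"
  assumes "A \<in> sets borel"
  shows "emeasure lborel ((\<lambda>x. x + c) -` A) = emeasure lborel A"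
proof -
  have "emeasure lborel A = emeasure (distr lborel borel ((+) c)) A"
    by (simp add: lborel_distr_plus)
  also have "\<dots> = emeasure lborel ((+) c -` A)"
    using assms by (subst emeasure_distr) auto
  also have "(+) c -` A = (\<lambda>x. x + c) -` A" by (auto simp: vimage_def add.commute)
  finally show ?thesis by simp
qed

text \<open>The interval is cut where y + a passes an integer. On each part the map is a
  translation, and the end point 1 is a null set.\<close>

lemma emeasure_rotation:
  fixes a :: real
  assumes [measurable]: "E \<in> sets borel"
  shows "emeasure lborel {y \<in> {0..1}. frac (y + a) \<in> E} = emeasure lborel (E \<inter> {0..1})"
proof -
  define f where "f = frac a"
  have f: "0 \<le> f" "f < 1" by (auto simp: f_def frac_lt_1)
  let ?L = "(\<lambda>y. y + f) -` (E \<inter> {f..<1})" and ?R = "(\<lambda>y. y + (f - 1)) -` (E \<inter> {0..<f})"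
  have [measurable]: "?L \<in> sets borel" "?R \<in> sets borel"
    by (auto intro!: measurable_sets_borel[of _ borel])
  have frac1: "frac (y + a) = y + f" if "0 \<le> y" "y + f < 1" for y
  proof -
    have "y + a = (y + f) + of_int \<lfloor>a\<rfloor>" by (simp add: f_def frac_def)
    then have "frac (y + a) = frac (y + f)" by (metis frac_add_of_int_right)
    with that f show ?thesis by (simp add: frac_eq)
  qed
  have frac2: "frac (y + a) = y + (f - 1)" if "y < 1" "y + f \<ge> 1" for y
  proof -
    have "y + a = (y + (f - 1)) + of_int (\<lfloor>a\<rfloor> + 1)" by (simp add: f_def frac_def)
    then have "frac (y + a) = frac (y + (f - 1))" by (metis frac_add_of_int_right)
    with that f show ?thesis by (simp add: frac_eq)
  qed
  have split: "{y \<in> {0..<1}. frac (y + a) \<in> E} = ?L \<union> ?R"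
  proof (intro set_eqI)
    fix y
    consider "0 \<le> y" "y + f < 1" | "y < 1" "y + f \<ge> 1" | "y < 0 \<or> y \<ge> 1" by linarith
    then show "y \<in> {y \<in> {0..<1}. frac (y + a) \<in> E} \<longleftrightarrow> y \<in> ?L \<union> ?R"
      using f by cases (auto simp: frac1 frac2)
  qed
  have "emeasure lborel {y \<in> {0..1}. frac (y + a) \<in> E} = emeasure lborel {y \<in> {0..<1}. frac (y + a) \<in> E}"
    using AE_lborel_singleton[of 1] by (intro emeasure_eq_AE) (auto elim!: eventually_mono)
  also have "\<dots> = emeasure lborel ?L + emeasure lborel ?R"
    unfolding split by (rule plus_emeasure[symmetric]) (auto simp: f)
  also have "\<dots> = emeasure lborel (E \<inter> {f..<1}) + emeasure lborel (E \<inter> {0..<f})"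
    by (simp add: emeasure_lborel_vimage_plus del: vimage_Int)
  also have "\<dots> = emeasure lborel (E \<inter> {f..<1} \<union> E \<inter> {0..<f})"
    by (rule plus_emeasure) auto
  also have "\<dots> = emeasure lborel (E \<inter> {0..1})"
    using AE_lborel_singleton[of 1] f by (intro emeasure_eq_AE) (auto elim!: eventually_mono)
  finally show ?thesis .
qed

lemma emeasure_lborel_prod_alt:
  fixes C :: "(real \<times> real) set"
  assumes "C \<in> sets borel"
  shows "emeasure lborel C = (\<integral>\<^sup>+x. emeasure lborel (Pair x -` C) \<partial>lborel)"
  using lborel.emeasure_pair_measure_alt[of C lborel, unfolded lborel_prod] assms by simp

lemma emeasure_lborel_prod_alt2:
  fixes C :: "(real \<times> real) set"
  assumes "C \<in> sets borel"
  shows "emeasure lborel C = (\<integral>\<^sup>+y. emeasure lborel ((\<lambda>x. (x, y)) -` C) \<partial>lborel)"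
  using lborel_pair.emeasure_pair_measure_alt2[of C, unfolded lborel_prod] assms by simp

text \<open>Each vertical fibre is rotated by its own angle, so Fubini reduces this to
  \<open>emeasure_rotation\<close>.\<close>

lemma emeasure_shear:
  fixes g :: "real \<Rightarrow> real" and B :: "(real \<times> real) set"
  assumes [measurable]: "g \<in> borel_measurable borel" "B \<in> sets borel"
  shows "emeasure lborel {z \<in> unit_square. (fst z, frac (snd z + g (fst z))) \<in> B} =
    emeasure lborel (B \<inter> unit_square)"
    (is "emeasure lborel ?C = emeasure lborel ?D")
proof -
  have "?C \<in> sets borel" "?D \<in> sets borel"
    by (auto intro!: borel_section)
  have "emeasure lborel (Pair x -` ?C) = emeasure lborel (Pair x -` ?D)" for x
  proof (cases "x \<in> {0..1}")
    case True
    have "Pair x -` B \<in> sets borel" by (auto intro!: measurable_sets_borel[of _ borel])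
    from emeasure_rotation[OF this, of "g x"] True show ?thesis
      by (auto simp: vimage_def Int_def conj_commute)
  qed (auto simp: vimage_def)
  then show ?thesis using \<open>?C \<in> sets borel\<close> \<open>?D \<in> sets borel\<close>
    by (simp only: emeasure_lborel_prod_alt)
qed

lemma emeasure_shear_fst:
  fixes a :: real and B :: "(real \<times> real) set"
  assumes [measurable]: "B \<in> sets borel"
  shows "emeasure lborel {z \<in> unit_square. (frac (fst z + a), snd z) \<in> B} =
    emeasure lborel (B \<inter> unit_square)"
    (is "emeasure lborel ?C = emeasure lborel ?D")
proof -
  have "?C \<in> sets borel" "?D \<in> sets borel"
    by (auto intro!: borel_section)
  have "emeasure lborel ((\<lambda>x. (x, y)) -` ?C) = emeasure lborel ((\<lambda>x. (x, y)) -` ?D)" for y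
  proof (cases "y \<in> {0..1}")
    case True
    have "(\<lambda>x. (x, y)) -` B \<in> sets borel" by (auto intro!: measurable_sets_borel[of _ borel])
    from emeasure_rotation[OF this, of a] True show ?thesis
      by (auto simp: vimage_def Int_def conj_commute)
  qed (auto simp: vimage_def)
  then show ?thesis using \<open>?C \<in> sets borel\<close> \<open>?D \<in> sets borel\<close>
    by (simp only: emeasure_lborel_prod_alt2)
qed

lemma emeasure_torus_translation:
  fixes a b :: real and B :: "(real \<times> real) set"
  assumes [measurable]: "B \<in> sets borel"
  shows "emeasure lborel {z \<in> unit_square. (frac (fst z + a), frac (snd z + b)) \<in> B} =
    emeasure lborel (B \<inter> unit_square)"
proof -
  let ?B = "{z. (frac (fst z + a), snd z) \<in> B}"
  have "?B \<in> sets borel" using borel_section[of "\<lambda>z. (frac (fst z + a), snd z)" B UNIV] by simp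
  from emeasure_shear[OF _ this, of "\<lambda>_. b"]
  have "emeasure lborel {z \<in> unit_square. (frac (fst z + a), frac (snd z + b)) \<in> B} =
    emeasure lborel (?B \<inter> unit_square)" by simp
  also have "?B \<inter> unit_square = {z \<in> unit_square. (frac (fst z + a), snd z) \<in> B}" by auto
  finally show ?thesis by (simp add: emeasure_shear_fst)
qed

lemma emeasure_lborel_strip:
  assumes "E \<in> sets borel"
  shows "emeasure lborel ({0..1::real} \<times> E) = emeasure lborel E"
  using lborel.emeasure_pair_measure_Times[of "{0..1::real}" lborel E, unfolded lborel_prod] assms
  by simp

lemma emeasure_unit_square: "emeasure lborel unit_square = 1"
  by (simp add: emeasure_lborel_strip)

text \<open>For g x = \<alpha> k - \<alpha> x the fractional part is that of the height at which the
  line through the point meets the vertical x = k. The strips around lattice points in both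
  directions of the theorem are measured this way.\<close>

lemma emeasure_frac_strip:
  fixes g :: "real \<Rightarrow> real"
  assumes [measurable]: "g \<in> borel_measurable borel" "E \<in> sets borel"
  shows "emeasure lborel {z \<in> unit_square. frac (snd z + g (fst z)) \<in> E} =
    emeasure lborel (E \<inter> {0..1})"
proof -
  have "(UNIV :: real set) \<times> E \<in> sets borel" 
    using measurable_sets_borel[OF borel_measurable_real_snd assms(2)] by (simp add: vimage_snd)
  from emeasure_shear[OF assms(1) this]
  have "emeasure lborel {z \<in> unit_square. frac (snd z + g (fst z)) \<in> E} =
    emeasure lborel (UNIV \<times> E \<inter> unit_square)" by simp
  also have "UNIV \<times> E \<inter> unit_square = {0..1} \<times> (E \<inter> {0..1})" by auto
  finally show ?thesis by (simp add: emeasure_lborel_strip)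
qed

text \<open>Regularity squeezes B between a compact K and an open U. A shift shorter than the
  distance from K to the complement of U carries K into U, so that only the small sets B - K and U -
  B and their translates contribute.\<close>

lemma translation_continuous_measure:
  fixes B :: "'a::euclidean_space set"
  assumes B: "B \<in> sets borel" "bounded B" and "\<epsilon> > (0::real)"
  obtains \<delta> where "\<delta> > 0"
    "\<And>v. norm v < \<delta> \<Longrightarrow> emeasure lborel {z. (z \<in> B) \<noteq> (z + v \<in> B)} \<le> ennreal \<epsilon>"
proof -
  \<comment> \<open>One quarter for each of the four sets in the final cover.\<close>
  define e where "e = \<epsilon> / 4"
  have e: "e > 0" using \<open>\<epsilon> > 0\<close> by (simp add: e_def)
  obtain U where U: "open U" "B \<subseteq> U" "emeasure lborel (U - B) < e"
    using outer_regular_lborel[OF B(1) e] by blast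
  obtain a where a: "B \<subseteq> cbox (- a) a" using bounded_subset_cbox_symmetric[OF B(2)] by blast
  \<comment> \<open>The inner compact set comes from outer regularity, applied to the complement of
    B in a box.\<close>
  obtain V where V: "open V" "cbox (- a) a - B \<subseteq> V" "emeasure lborel (V - (cbox (- a) a - B)) < e"
    using outer_regular_lborel[of "cbox (- a) a - B", OF _ e] B(1) by auto
  define K where "K = cbox (- a) a - V"
  have K: "compact K" "K \<subseteq> B" "B - K \<subseteq> V - (cbox (- a) a - B)"
    using V a by (auto simp: K_def compact_diff)
  have meas: "U \<in> sets borel" "V \<in> sets borel" "K \<in> sets borel"
    using U V K by (auto intro: borel_compact)
  have BK: "emeasure lborel (B - K) \<le> e"
    using emeasure_mono[OF K(3), of lborel] meas B(1) V(3) by (auto intro: order_trans less_imp_le)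
  obtain \<delta> where \<delta>: "\<delta> > 0" "\<And>x y. x \<in> K \<Longrightarrow> y \<in> - U \<Longrightarrow> \<delta> \<le> dist x y"
    using separate_compact_closed[of K "- U"] K U by (metis Compl_disjoint closed_Compl
        disjoint_iff subset_eq ComplD)
  have "emeasure lborel {z. (z \<in> B) \<noteq> (z + v \<in> B)} \<le> ennreal \<epsilon>" if v: "norm v < \<delta>" for v
  proof -
    have KU: "z + v \<in> U" "z - v \<in> U" if "z \<in> K" for z
      using \<delta>(2)[OF that, of "z + v"] \<delta>(2)[OF that, of "z - v"] v by (auto simp: dist_norm)
    let ?s = "\<lambda>A. (\<lambda>z. z + v) -` A"
    have "{z. (z \<in> B) \<noteq> (z + v \<in> B)} \<subseteq> ((B - K) \<union> ?s (U - B)) \<union> (?s (B - K) \<union> (U - B))"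
    proof
      fix z assume "z \<in> {z. (z \<in> B) \<noteq> (z + v \<in> B)}"
      then show "z \<in> ((B - K) \<union> ?s (U - B)) \<union> (?s (B - K) \<union> (U - B))"
        using KU(1)[of z] KU(2)[of "z + v"] by auto
    qed
    moreover have s: "?s A \<in> sets lborel" if "A \<in> sets borel" for A
      using measurable_sets_borel[of "\<lambda>z. z + v" borel A] that by simp
    ultimately have "emeasure lborel {z. (z \<in> B) \<noteq> (z + v \<in> B)} \<le>
        emeasure lborel (((B - K) \<union> ?s (U - B)) \<union> (?s (B - K) \<union> (U - B)))"
      using meas B(1) by (intro emeasure_mono sets.Un s) auto
    also have "\<dots> \<le> emeasure lborel ((B - K) \<union> ?s (U - B)) + emeasure lborel (?s (B - K) \<union> (U - B))"
      using meas B(1) by (intro emeasure_subadditive sets.Un s) auto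
    also have "\<dots> \<le> (emeasure lborel (B - K) + emeasure lborel (?s (U - B))) +
        (emeasure lborel (?s (B - K)) + emeasure lborel (U - B))"
      using meas B(1) by (intro add_mono emeasure_subadditive s) auto
    also have "\<dots> \<le> (ennreal e + ennreal e) + (ennreal e + ennreal e)"
      using meas B(1) BK U(3) by (intro add_mono) (auto simp: emeasure_lborel_vimage_plus intro: less_imp_le)
    also have "\<dots> = ennreal \<epsilon>" using e by (simp add: e_def flip: ennreal_plus)
    finally show ?thesis .
  qed
  with \<delta>(1) show ?thesis using that by blast
qed

lemma emeasure_in_unit_square:
  assumes "B \<subseteq> unit_square"
  shows "emeasure lborel B = ennreal (measure lborel B)"
proof -
  have "emeasure lborel B \<le> emeasure lborel unit_square" using assms by (intro emeasure_mono) auto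
  then have "emeasure lborel B \<noteq> top"
    using neq_top_trans[OF ennreal_one_neq_top] by (simp add: emeasure_unit_square)
  then show ?thesis by (rule emeasure_eq_ennreal_measure)
qed

section \<open>The area, square by square\<close>

lemma sets_squares_area_iff:
  "A \<in> sets (squares_area d) \<longleftrightarrow>
    A \<subseteq> squares d \<and> (\<forall>i\<in>{1..d}. {z \<in> unit_square. (i, z) \<in> A} \<in> sets borel)"
    (is "_ \<longleftrightarrow> _ \<and> (\<forall>i\<in>_. ?S i \<in> _)")
proof (intro iffI conjI ballI)
  assume A: "A \<in> sets (squares_area d)"
  then show sub: "A \<subseteq> squares d"
    using sets.sets_into_space space_squares_area by blast
  fix i
  have "Pair i -` A \<in> sets (restrict_space lborel unit_square)"
    using A unfolding squares_area_def by (rule sets_Pair1)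
  then have "Pair i -` A \<in> sets borel"
    using sets_restrict_space_iff[of unit_square lborel] by simp
  moreover have "?S i = Pair i -` A" using sub by (auto simp: squares_def)
  ultimately show "?S i \<in> sets borel" by simp
next
  assume A: "A \<subseteq> squares d \<and> (\<forall>i\<in>{1..d}. ?S i \<in> sets borel)"
  have "(\<Union>i\<in>{1..d}. {i} \<times> ?S i) \<in> sets (squares_area d)"
  proof (intro sets.finite_UN)
    fix i assume i: "i \<in> {1..d}"
    show "{i} \<times> ?S i \<in> sets (squares_area d)"
      unfolding squares_area_def
    proof (rule pair_measureI)
      show "{i} \<in> sets (uniform_count_measure {1..d})"
        using i by (simp add: sets_uniform_count_measure)
      show "?S i \<in> sets (restrict_space lborel unit_square)"
        using A i by (subst sets_restrict_space_iff) auto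
    qed
  qed simp
  also have "(\<Union>i\<in>{1..d}. {i} \<times> ?S i) = A" using A by (force simp: squares_def)
  finally show "A \<in> sets (squares_area d)" .
qed

lemma emeasure_squares_area:
  assumes A: "A \<in> sets (squares_area d)"
  shows "emeasure (squares_area d) A =
    (\<Sum>i\<in>{1..d}. ennreal (1 / d) * emeasure lborel {z \<in> unit_square. (i, z) \<in> A})"
proof -
  let ?R = "restrict_space lborel unit_square"
  have eR: "emeasure ?R B = emeasure lborel B" if "B \<subseteq> unit_square" for B
    using that by (intro emeasure_restrict_space) auto
  interpret R: finite_measure ?R
    using eR[of unit_square] emeasure_unit_square
    by (intro finite_measureI) (simp add: space_restrict_space)
  have sub: "A \<subseteq> squares d" using A by (simp add: sets_squares_area_iff)
  have "emeasure (squares_area d) A = (\<integral>\<^sup>+i. emeasure ?R (Pair i -` A) \<partial>uniform_count_measure {1..d})"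
    using A unfolding squares_area_def by (rule R.emeasure_pair_measure_alt)
  also have "\<dots> = (\<Sum>i\<in>{1..d}. ennreal (1 / d) * emeasure ?R (Pair i -` A))"
    unfolding uniform_count_measure_def by (subst nn_integral_point_measure_finite) auto
  also have "\<dots> = (\<Sum>i\<in>{1..d}. ennreal (1 / d) * emeasure lborel {z \<in> unit_square. (i, z) \<in> A})"
  proof (intro sum.cong refl)
    fix i
    have "Pair i -` A = {z \<in> unit_square. (i, z) \<in> A}" using sub by (auto simp: squares_def)
    then show "ennreal (1 / d) * emeasure ?R (Pair i -` A) =
        ennreal (1 / d) * emeasure lborel {z \<in> unit_square. (i, z) \<in> A}"
      by (subst eR) auto
  qed
  finally show ?thesis .
qed

context square_tiled
begin

abbreviation "M \<equiv> surface_area d \<tau> \<sigma>"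
abbreviation "X \<equiv> surface d \<tau> \<sigma>"

definition sec :: "point set set \<Rightarrow> nat \<Rightarrow> (real \<times> real) set" where
  "sec A i = {z \<in> unit_square. \<pi> (i, z) \<in> A}"

lemma sec_subset: "sec A i \<subseteq> unit_square"
  by (auto simp: sec_def)

lemma in_squares: "(i, z) \<in> squares d \<longleftrightarrow> i \<in> {1..d} \<and> z \<in> unit_square"
  by (auto simp: squares_def)

lemma sets_M: "A \<in> sets M \<longleftrightarrow> A \<subseteq> X \<and> (\<forall>i\<in>{1..d}. sec A i \<in> sets borel)"
proof -
  have "{z \<in> unit_square. (i, z) \<in> {p \<in> squares d. \<pi> p \<in> A}} = sec A i" if "i \<in> {1..d}" for i
    using that by (auto simp: sec_def in_squares)
  then show ?thesis by (simp add: sets_surface_area sets_squares_area_iff)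
qed

lemma space_M [simp]: "space M = X"
  unfolding surface_area_def space_distr by (rule space_measure_of) auto

lemma emeasure_M:
  assumes "A \<in> sets M"
  shows "emeasure M A = (\<Sum>i\<in>{1..d}. ennreal (1 / d) * emeasure lborel (sec A i))"
proof -
  let ?\<Sigma> = "sigma X {A. A \<subseteq> X \<and> {p \<in> squares d. \<pi> p \<in> A} \<in> sets (squares_area d)}"
  have sets: "sets ?\<Sigma> = {A. A \<subseteq> X \<and> {p \<in> squares d. \<pi> p \<in> A} \<in> sets (squares_area d)}"
    using sets_surface_area[of d \<tau> \<sigma>] unfolding surface_area_def by simp
  have "\<pi> \<in> measurable (squares_area d) ?\<Sigma>"
  proof (rule measurableI)
    show "\<pi> p \<in> space ?\<Sigma>" if "p \<in> space (squares_area d)" for p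
      using that by (subst space_measure_of) (auto simp: space_squares_area surface_def)
    show "\<pi> -` A \<inter> space (squares_area d) \<in> sets (squares_area d)" if "A \<in> sets ?\<Sigma>" for A
      using that unfolding sets by (auto simp: space_squares_area vimage_def Int_def conj_commute)
  qed
  moreover have A: "A \<in> sets ?\<Sigma>" using assms unfolding surface_area_def by simp
  ultimately have "emeasure M A = emeasure (squares_area d) (\<pi> -` A \<inter> space (squares_area d))"
    unfolding surface_area_def by (rule emeasure_distr)
  also have "\<pi> -` A \<inter> space (squares_area d) = {p \<in> squares d. \<pi> p \<in> A}"
    by (auto simp: space_squares_area)
  also have "emeasure (squares_area d) \<dots> = (\<Sum>i\<in>{1..d}. ennreal (1 / d) *
      emeasure lborel {z \<in> unit_square. (i, z) \<in> {p \<in> squares d. \<pi> p \<in> A}})"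
    using A unfolding sets by (intro emeasure_squares_area) auto
  also have "\<dots> = (\<Sum>i\<in>{1..d}. ennreal (1 / d) * emeasure lborel (sec A i))"
    by (intro sum.cong refl arg_cong2[where f = "(*)"] arg_cong[where f = "emeasure lborel"])
      (auto simp: sec_def in_squares)
  finally show ?thesis .
qed

lemma sec_surface: "i \<in> {1..d} \<Longrightarrow> sec X i = unit_square"
  by (auto simp: sec_def surface_def in_squares)

lemma prob_space_M:
  assumes "d > 0"
  shows "prob_space M"
proof
  have "emeasure M (space M) = (\<Sum>i\<in>{1..d}. ennreal (1 / d) * emeasure lborel (sec X i))"
    using emeasure_M[of X] by (simp add: sets_M sec_surface)
  also have "\<dots> = (\<Sum>i\<in>{1..d}. ennreal (1 / d))"
    by (intro sum.cong) (simp_all add: sec_surface emeasure_unit_square)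
  also have "\<dots> = ennreal (\<Sum>i\<in>{1..d}. 1 / d)" by (rule sum_ennreal) auto
  finally show "emeasure M (space M) = 1" using assms by simp
qed

section \<open>The flow as a skew product over the torus\<close>

definition singular :: "(real \<times> real) set" where
  "singular = {z. \<not> generic (snd z - \<alpha> * fst z)}"

lemma singular_borel [measurable]: "singular \<in> sets borel"
proof -
  have "singular = (\<Union>m::int. (\<lambda>z. frac (snd z - \<alpha> * fst z + \<alpha> * of_int m)) -` {0})"
    by (auto simp: singular_def generic_def frac_eq_0_iff)
  also have "\<dots> \<in> sets borel"
    by (intro sets.countable_UN') (auto intro!: measurable_sets_borel[of _ borel])
  finally show ?thesis .
qed

text \<open>Every vertical section is countable, with at most one height for each lattice
  point.\<close>

lemma singular_null: "emeasure lborel singular = 0"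
proof -
  have "emeasure lborel (Pair x -` singular) = 0" for x
  proof (rule emeasure_lborel_countable)
    have "Pair x -` singular \<subseteq> (\<Union>m::int. \<Union>n::int. {of_int n + \<alpha> * x - \<alpha> * of_int m})"
    proof
      fix y assume "y \<in> Pair x -` singular"
      then obtain m n :: int where "y - \<alpha> * x + \<alpha> * of_int m = of_int n"
        by (auto simp: singular_def generic_def elim!: Ints_cases)
      then have "y = of_int n + \<alpha> * x - \<alpha> * of_int m" by linarith
      then show "y \<in> (\<Union>m::int. \<Union>n::int. {of_int n + \<alpha> * x - \<alpha> * of_int m})" by blast
    qed
    moreover have "countable (\<Union>m::int. \<Union>n::int. {of_int n + \<alpha> * x - \<alpha> * of_int m})" by auto
    ultimately show "countable (Pair x -` singular)" by (rule countable_subset)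
  qed
  then show ?thesis using emeasure_lborel_prod_alt[OF singular_borel] by simp
qed

text \<open>Each new factor depends on b through a floor, which takes countably many values.\<close>

lemma hol_measurable: "(\<lambda>b. hol b m i) \<in> measurable borel (count_space UNIV)"
proof (induction m rule: int_induct[where k = 0])
  case (step1 m)
  have "(\<lambda>b. crossing \<lfloor>b + \<alpha> * of_int (m + 1)\<rfloor> (hol b m i)) \<in> measurable borel (count_space UNIV)"
    by (rule measurable_compose_countable[where g = "\<lambda>b. \<lfloor>b + \<alpha> * of_int (m + 1)\<rfloor>"])
      (auto intro: measurable_compose[OF step1(2)])
  then show ?case by (simp add: hol_succ)
next
  case (step2 m)
  have "(\<lambda>b. inv (crossing \<lfloor>b + \<alpha> * of_int m\<rfloor>) (hol b m i)) \<in> measurable borel (count_space UNIV)"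
    by (rule measurable_compose_countable[where g = "\<lambda>b. \<lfloor>b + \<alpha> * of_int m\<rfloor>"])
      (auto intro: measurable_compose[OF step2(2)])
  then show ?case by (simp add: hol_def int_iter_pred crossing_bij)
qed simp

definition next_label :: "real \<Rightarrow> nat \<Rightarrow> real \<times> real \<Rightarrow> nat" where
  "next_label t i z = label (snd z - \<alpha> * fst z) \<lfloor>fst z + t * cos \<theta>\<rfloor> \<lfloor>snd z + t * sin \<theta>\<rfloor> i"

definition torus_flow :: "real \<Rightarrow> real \<times> real \<Rightarrow> real \<times> real" where
  "torus_flow t z = (frac (fst z + t * cos \<theta>), frac (snd z + t * sin \<theta>))"

lemma next_label_measurable: "next_label t i \<in> measurable borel (count_space UNIV)"
proof -
  have "(\<lambda>z. label (snd z - \<alpha> * fst z) m n i) \<in> measurable borel (count_space UNIV)" for m n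
    unfolding label_def comp_apply
    by (rule measurable_compose[OF measurable_compose[OF _ hol_measurable]]) auto
  then have "(\<lambda>z. label (snd z - \<alpha> * fst z) m \<lfloor>snd z + t * sin \<theta>\<rfloor> i) \<in> measurable borel (count_space UNIV)" for m
    by (rule measurable_compose_countable[where g = "\<lambda>z. \<lfloor>snd z + t * sin \<theta>\<rfloor>"]) auto
  then show ?thesis unfolding next_label_def[abs_def]
    by (rule measurable_compose_countable[where g = "\<lambda>z. \<lfloor>fst z + t * cos \<theta>\<rfloor>"]) auto
qed

lemma torus_flow_measurable: "torus_flow t \<in> borel_measurable borel"
  unfolding torus_flow_def[abs_def] by measurable

lemma torus_flow_in: "torus_flow t z \<in> unit_square"
  by (auto simp: torus_flow_def frac_lt_1 less_imp_le)

lemma next_label_in: "i \<in> {1..d} \<Longrightarrow> next_label t i z \<in> {1..d}"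
  unfolding next_label_def by (rule label_in)

lemma flow_regular:
  assumes "i \<in> {1..d}" "z \<in> unit_square" "z \<notin> singular"
  shows "flow t (\<pi> (i, z)) = \<pi> (next_label t i z, torus_flow t z)"
proof -
  obtain x y where z: "z = (x, y)" by (metis surj_pair)
  have Y: "y - \<alpha> * x + \<alpha> * (x + t * cos \<theta>) = y + t * sin \<theta>"
    by (simp add: sin_eq algebra_simps)
  have "flow t (\<pi> (i, x, y)) = leaf (y - \<alpha> * x) i (x + t * cos \<theta>)"
    using assms by (intro flow_generic) (simp_all add: z in_squares singular_def)
  then show ?thesis
    unfolding leaf_def Y by (simp add: z next_label_def torus_flow_def)
qed

lemma flow_singular: "z \<in> singular \<Longrightarrow> flow t (\<pi> (i, z)) = \<pi> (i, z)"
  using flow_not_generic by (cases z) (simp add: singular_def)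

lemma flow_in_X: "p \<in> X \<Longrightarrow> flow t p \<in> X"
proof -
  assume "p \<in> X"
  then obtain i z where p: "p = \<pi> (i, z)" "(i, z) \<in> squares d" by (auto simp: surface_def)
  show ?thesis
  proof (cases "z \<in> singular")
    case True
    then show ?thesis using flow_singular p \<open>p \<in> X\<close> by simp
  next
    case False
    then have "(next_label t i z, torus_flow t z) \<in> squares d"
      using p next_label_in torus_flow_in by (simp add: in_squares)
    then show ?thesis using False p flow_regular by (auto simp: in_squares surface_def)
  qed
qed

lemma sec_regular:
  assumes "i \<in> {1..d}" "z \<in> unit_square" "z \<notin> singular"
  shows "flow t (\<pi> (i, z)) \<in> A \<longleftrightarrow> torus_flow t z \<in> sec A (next_label t i z)"
  using torus_flow_in[of t z] by (simp add: flow_regular[OF assms] sec_def)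

lemma piece_borel:
  assumes "A \<in> sets M" "j \<in> {1..d}"
  shows "{z \<in> unit_square. torus_flow t z \<in> sec A j \<and> next_label t i z = j} \<in> sets borel"
proof -
  have "{z \<in> unit_square. torus_flow t z \<in> sec A j} \<in> sets borel"
    using assms by (intro borel_section torus_flow_measurable) (auto simp: sets_M)
  moreover have "next_label t i -` {j} \<inter> space borel \<in> sets borel"
    by (rule measurable_sets[OF next_label_measurable]) simp
  moreover have "{z \<in> unit_square. torus_flow t z \<in> sec A j \<and> next_label t i z = j} =
    {z \<in> unit_square. torus_flow t z \<in> sec A j} \<inter> (next_label t i -` {j} \<inter> space borel)" by auto
  ultimately show ?thesis by simp
qed

lemma flow_sec_borel:
  assumes A: "A \<in> sets M" and i: "i \<in> {1..d}"
  shows "{z \<in> unit_square. flow t (\<pi> (i, z)) \<in> A} \<in> sets borel"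
proof -
  let ?P = "\<lambda>j. {z \<in> unit_square. torus_flow t z \<in> sec A j \<and> next_label t i z = j}"
  have "{z \<in> unit_square. flow t (\<pi> (i, z)) \<in> A} =
    (sec A i \<inter> singular) \<union> ((\<Union>j\<in>{1..d}. ?P j) - singular)"
  proof (intro set_eqI)
    fix z
    show "z \<in> {z \<in> unit_square. flow t (\<pi> (i, z)) \<in> A} \<longleftrightarrow>
      z \<in> (sec A i \<inter> singular) \<union> ((\<Union>j\<in>{1..d}. ?P j) - singular)"
    proof (cases "z \<in> singular")
      case True
      then show ?thesis by (auto simp: flow_singular sec_def)
    next
      case False
      then show ?thesis using sec_regular[OF i _ False] next_label_in[OF i, of t z] by auto
    qed
  qed
  moreover have "sec A i \<in> sets borel" using A i by (auto simp: sets_M)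
  moreover have "(\<Union>j\<in>{1..d}. ?P j) \<in> sets borel" using piece_borel[OF A] by (intro sets.finite_UN) auto
  ultimately show ?thesis by auto
qed

lemma flow_vimage_sets:
  assumes "A \<in> sets M"
  shows "{p \<in> X. flow t p \<in> A} \<in> sets M" "i \<in> {1..d} \<Longrightarrow> sec {p \<in> X. flow t p \<in> A} i = {z \<in> unit_square. flow t (\<pi> (i, z)) \<in> A}"
proof -
  show *: "sec {p \<in> X. flow t p \<in> A} i = {z \<in> unit_square. flow t (\<pi> (i, z)) \<in> A}" if "i \<in> {1..d}" for i
    using that by (auto simp: sec_def surface_def in_squares)
  show "{p \<in> X. flow t p \<in> A} \<in> sets M"
    using flow_sec_borel[OF assms] by (simp add: sets_M *)
qed

lemma flow_measurable: "flow t \<in> measurable M M"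
proof (rule measurableI)
  fix A assume "A \<in> sets M"
  have "flow t -` A \<inter> space M = {p \<in> X. flow t p \<in> A}" by auto
  then show "flow t -` A \<inter> space M \<in> sets M" using flow_vimage_sets[OF \<open>A \<in> sets M\<close>] by simp
qed (simp add: flow_in_X)

lemma next_label_permutes: "(\<lambda>i. next_label t i z) permutes {1..d}"
  unfolding next_label_def by (rule label_permutes)

lemma next_label_inj: "next_label t i z = next_label t j z \<longleftrightarrow> i = j"
  using permutes_inj[OF next_label_permutes[of t z]] by (auto simp: inj_def)

text \<open>For fixed z the arrival label is a permutation of the starting label. Sorting by arrival
  label and exchanging the two sums therefore leaves a full torus translation in each square, which
  preserves area.\<close>

lemma flow_sec_emeasure:
  assumes A: "A \<in> sets M"
  shows "(\<Sum>i\<in>{1..d}. emeasure lborel {z \<in> unit_square. flow t (\<pi> (i, z)) \<in> A}) =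
    (\<Sum>i\<in>{1..d}. emeasure lborel (sec A i))"
proof -
  let ?P = "\<lambda>i j. {z \<in> unit_square. torus_flow t z \<in> sec A j \<and> next_label t i z = j}"
  have borel: "?P i j \<in> sets lborel" if "j \<in> {1..d}" for i j
    using piece_borel[OF A that] by simp
  have "emeasure lborel {z \<in> unit_square. flow t (\<pi> (i, z)) \<in> A} = (\<Sum>j\<in>{1..d}. emeasure lborel (?P i j))"
    if i: "i \<in> {1..d}" for i
  proof -
    have "AE z in lborel. z \<notin> singular"
      using singular_null by (intro AE_not_in null_setsI) auto
    then have "emeasure lborel {z \<in> unit_square. flow t (\<pi> (i, z)) \<in> A} = emeasure lborel (\<Union>j\<in>{1..d}. ?P i j)"
    proof (intro emeasure_eq_AE)
      assume "AE z in lborel. z \<notin> singular"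
      then show "AE z in lborel. z \<in> {z \<in> unit_square. flow t (\<pi> (i, z)) \<in> A} \<longleftrightarrow> z \<in> (\<Union>j\<in>{1..d}. ?P i j)"
      proof (rule eventually_mono)
        fix z assume "z \<notin> singular"
        then show "z \<in> {z \<in> unit_square. flow t (\<pi> (i, z)) \<in> A} \<longleftrightarrow> z \<in> (\<Union>j\<in>{1..d}. ?P i j)"
          using sec_regular[OF i, of z t A] next_label_in[OF i, of t z] by auto
      qed
      show "{z \<in> unit_square. flow t (\<pi> (i, z)) \<in> A} \<in> sets lborel" using flow_sec_borel[OF A i] by simp
      show "(\<Union>j\<in>{1..d}. ?P i j) \<in> sets lborel" using borel by (intro sets.finite_UN) auto
    qed
    also have "\<dots> = (\<Sum>j\<in>{1..d}. emeasure lborel (?P i j))"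
      by (rule sum_emeasure[symmetric]) (use borel in \<open>auto simp: disjoint_family_on_def\<close>)
    finally show ?thesis .
  qed
  then have "(\<Sum>i\<in>{1..d}. emeasure lborel {z \<in> unit_square. flow t (\<pi> (i, z)) \<in> A}) =
      (\<Sum>i\<in>{1..d}. \<Sum>j\<in>{1..d}. emeasure lborel (?P i j))" by (rule sum.cong[OF refl])
  also have "\<dots> = (\<Sum>j\<in>{1..d}. \<Sum>i\<in>{1..d}. emeasure lborel (?P i j))" by (rule sum.swap)
  also have "\<dots> = (\<Sum>j\<in>{1..d}. emeasure lborel (sec A j))"
  proof (rule sum.cong[OF refl])
    fix j assume j: "j \<in> {1..d}"
    have "(\<Sum>i\<in>{1..d}. emeasure lborel (?P i j)) = emeasure lborel (\<Union>i\<in>{1..d}. ?P i j)"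
    proof (rule sum_emeasure)
      show "disjoint_family_on (\<lambda>i. ?P i j) {1..d}"
        by (auto simp: disjoint_family_on_def next_label_inj)
    qed (use borel[OF j] in auto)
    also have "(\<Union>i\<in>{1..d}. ?P i j) = {z \<in> unit_square. torus_flow t z \<in> sec A j}"
    proof (intro set_eqI)
      fix z
      have "\<exists>i\<in>{1..d}. next_label t i z = j"
        using permutes_image[OF next_label_permutes[of t z]] j by (metis imageE)
      then show "z \<in> (\<Union>i\<in>{1..d}. ?P i j) \<longleftrightarrow> z \<in> {z \<in> unit_square. torus_flow t z \<in> sec A j}" by auto
    qed
    also have "emeasure lborel \<dots> = emeasure lborel (sec A j \<inter> unit_square)"
      unfolding torus_flow_def using A j by (intro emeasure_torus_translation) (auto simp: sets_M)
    also have "sec A j \<inter> unit_square = sec A j" using sec_subset by blast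
    finally show "(\<Sum>i\<in>{1..d}. emeasure lborel (?P i j)) = emeasure lborel (sec A j)" .
  qed
  finally show ?thesis .
qed

lemma flow_emeasure:
  assumes A: "A \<in> sets M"
  shows "emeasure M {p \<in> X. flow t p \<in> A} = emeasure M A"
proof -
  have "emeasure M {p \<in> X. flow t p \<in> A} =
      (\<Sum>i\<in>{1..d}. ennreal (1 / d) * emeasure lborel {z \<in> unit_square. flow t (\<pi> (i, z)) \<in> A})"
    unfolding emeasure_M[OF flow_vimage_sets(1)[OF A]]
    by (intro sum.cong refl) (simp only: flow_vimage_sets(2)[OF A])
  also have "\<dots> = ennreal (1 / d) * (\<Sum>i\<in>{1..d}. emeasure lborel (sec A i))"
    by (simp only: flow_sec_emeasure[OF A] flip: sum_distrib_left)
  finally show ?thesis by (simp only: emeasure_M[OF A] sum_distrib_left)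
qed

lemma measure_preserving:
  assumes "d > 0"
  shows "measure_preserving_flow M flow"
  unfolding measure_preserving_flow_def
proof (intro conjI ballI allI prob_space_M assms flow_0 flow_add flow_measurable)
  fix t
  show "distr M M (flow t) = M"
  proof (rule measure_eqI)
    fix A assume "A \<in> sets (distr M M (flow t))"
    then have A: "A \<in> sets M" by simp
    have "flow t -` A \<inter> space M = {p \<in> X. flow t p \<in> A}" by auto
    then show "emeasure (distr M M (flow t)) A = emeasure M A"
      using flow_emeasure[OF A, of t] by (simp add: emeasure_distr[OF flow_measurable A])
  qed simp
qed

section \<open>Displacement of sets and rigidity\<close>

definition displacement :: "real \<Rightarrow> point set set \<Rightarrow> real" where
  "displacement t A = measure M {p \<in> X. (flow t p \<in> A) \<noteq> (p \<in> A)}"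

lemma displacement_set:
  assumes "A \<in> sets M"
  shows "{p \<in> X. (flow t p \<in> A) \<noteq> (p \<in> A)} \<in> sets M"
proof -
  have "A \<subseteq> X" using assms by (simp add: sets_M)
  then have "{p \<in> X. (flow t p \<in> A) \<noteq> (p \<in> A)} = sym_diff {p \<in> X. flow t p \<in> A} A" by auto
  then show ?thesis using flow_vimage_sets(1)[OF assms, of t] assms by auto
qed

lemma flow_inverse: "flow (- t) (flow t p) = p" "flow t (flow (- t) p) = p"
  using flow_add[of "- t" t p] flow_add[of t "- t" p] by (simp_all add: flow_0)

lemma sym_diff_flow:
  assumes A: "A \<in> sets M"
  shows "measure M (sym_diff (flow t ` A) A) = displacement (- t) A"
proof -
  have "A \<subseteq> X" using A by (simp add: sets_M)
  have "flow t ` A = {p \<in> X. flow (- t) p \<in> A}"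
    using \<open>A \<subseteq> X\<close> flow_in_X[of _ t] by (auto simp: flow_inverse image_iff) (metis flow_inverse(2))
  then have "sym_diff (flow t ` A) A = {p \<in> X. (flow (- t) p \<in> A) \<noteq> (p \<in> A)}"
    using \<open>A \<subseteq> X\<close> by auto
  then show ?thesis by (simp add: displacement_def)
qed

text \<open>The set for t is the preimage under \<open>flow t\<close> of the set for -t. The sign of
  time is therefore free, and the flow may be run in the sense in which the horizontal coordinate
  grows.\<close>

lemma displacement_minus:
  assumes A: "A \<in> sets M"
  shows "displacement (- t) A = displacement t A"
proof -
  have "{p \<in> X. flow t p \<in> {p \<in> X. (flow (- t) p \<in> A) \<noteq> (p \<in> A)}} = {p \<in> X. (flow t p \<in> A) \<noteq> (p \<in> A)}"
    using flow_in_X[of _ t] by (auto simp: flow_inverse)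
  then show ?thesis
    using flow_emeasure[OF displacement_set[OF A, of "- t"], of t]
    unfolding displacement_def measure_def by simp
qed

lemma rigid_iff:
  assumes "d > 0"
  shows "rigid M flow \<longleftrightarrow> (\<exists>Q :: nat \<Rightarrow> real. filterlim Q at_top sequentially \<and>
    (\<forall>A\<in>sets M. (\<lambda>n. displacement (Q n) A) \<longlonglongrightarrow> 0))"
proof -
  have "measure M (sym_diff (flow t ` A) A) = displacement t A" if "A \<in> sets M" for t A
    using sym_diff_flow[OF that] displacement_minus[OF that] by simp
  then show ?thesis
    using measure_preserving[OF assms] unfolding rigid_def by (simp cong: ball_cong)
qed

lemma sec_displacement_set:
  assumes "i \<in> {1..d}"
  shows "sec {p \<in> X. (flow t p \<in> A) \<noteq> (p \<in> A)} i =
    {z \<in> unit_square. (flow t (\<pi> (i, z)) \<in> A) \<noteq> (\<pi> (i, z) \<in> A)}"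
  using assms by (auto simp: sec_def surface_def in_squares)

lemma displacement_sec_borel:
  assumes "A \<in> sets M" "i \<in> {1..d}"
  shows "{z \<in> unit_square. (flow t (\<pi> (i, z)) \<in> A) \<noteq> (\<pi> (i, z) \<in> A)} \<in> sets borel"
proof -
  have "sec {p \<in> X. (flow t p \<in> A) \<noteq> (p \<in> A)} i \<in> sets borel"
    using displacement_set[OF assms(1), of t] assms(2) unfolding sets_M by blast
  then show ?thesis by (simp only: sec_displacement_set[OF assms(2)])
qed

lemma displacement_eq:
  assumes A: "A \<in> sets M"
  shows "displacement t A =
    (\<Sum>i\<in>{1..d}. measure lborel {z \<in> unit_square. (flow t (\<pi> (i, z)) \<in> A) \<noteq> (\<pi> (i, z) \<in> A)}) / d"
proof -
  let ?D = "{p \<in> X. (flow t p \<in> A) \<noteq> (p \<in> A)}"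
  let ?S = "\<lambda>i. {z \<in> unit_square. (flow t (\<pi> (i, z)) \<in> A) \<noteq> (\<pi> (i, z) \<in> A)}"
  have "emeasure M ?D = (\<Sum>i\<in>{1..d}. ennreal (1 / d) * emeasure lborel (sec ?D i))"
    by (rule emeasure_M[OF displacement_set[OF A]])
  also have "\<dots> = (\<Sum>i\<in>{1..d}. ennreal (measure lborel (?S i) / d))"
  proof (rule sum.cong[OF refl])
    fix i assume i: "i \<in> {1..d}"
    have "emeasure lborel (sec ?D i) = ennreal (measure lborel (?S i))"
      unfolding sec_displacement_set[OF i] by (rule emeasure_in_unit_square) auto
    then show "ennreal (1 / d) * emeasure lborel (sec ?D i) = ennreal (measure lborel (?S i) / d)"
      by (simp flip: ennreal_mult)
  qed
  also have "\<dots> = ennreal (\<Sum>i\<in>{1..d}. measure lborel (?S i) / d)" by (rule sum_ennreal) simp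
  finally show ?thesis
    unfolding displacement_def measure_def[of M] by (simp add: sum_nonneg sum_divide_distrib)
qed

end

section \<open>Unbounded partial quotients\<close>

lemma floor_add_small:
  fixes y \<delta> :: real
  assumes "frac y \<in> {\<bar>\<delta>\<bar>..<1 - \<bar>\<delta>\<bar>}"
  shows "\<lfloor>y + (of_int p + \<delta>)\<rfloor> = \<lfloor>y\<rfloor> + p"
proof -
  have "of_int (\<lfloor>y\<rfloor> + p) \<le> y + (of_int p + \<delta>)" "y + (of_int p + \<delta>) < of_int (\<lfloor>y\<rfloor> + p) + 1"
    using assms unfolding frac_def by auto
  then show ?thesis by (simp add: floor_eq_iff)
qed

lemma emeasure_boundary_strip:
  fixes \<delta> :: real
  assumes "\<delta> \<ge> 0"
  shows "emeasure lborel ({0..\<delta>} \<union> {1 - \<delta>..1}) \<le> ennreal (2 * \<delta>)"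
proof -
  have "emeasure lborel ({0..\<delta>} \<union> {1 - \<delta>..1}) \<le> emeasure lborel {0..\<delta>} + emeasure lborel {1 - \<delta>..1}"
    by (rule emeasure_subadditive) auto
  also have "\<dots> = ennreal (2 * \<delta>)" using assms by (simp flip: ennreal_plus)
  finally show ?thesis .
qed

context square_tiled
begin

section \<open>Periodicity of the cocycle near a convergent\<close>

text \<open>By \<open>crossing_add\<close>, each factor after column q is the conjugate by
  \<sigma>^p of the factor q columns earlier, and the inner powers of \<sigma> telescope.\<close>

lemma hol_shift:
  assumes "\<And>j. 1 \<le> j \<Longrightarrow> j \<le> int k \<Longrightarrow> \<lfloor>b + \<alpha> * of_int (q + j)\<rfloor> = \<lfloor>b + \<alpha> * of_int j\<rfloor> + p"
  shows "hol b (q + int k) = sg (- p) \<circ> hol b (int k) \<circ> sg p \<circ> hol b q"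
  using assms
proof (induction k)
  case 0
  show ?case by (simp add: sg_minus)
next
  case (Suc k)
  let ?F = "\<lfloor>b + \<alpha> * of_int (int k + 1)\<rfloor>"
  have IH: "hol b (q + int k) = sg (- p) \<circ> hol b (int k) \<circ> sg p \<circ> hol b q"
    by (rule Suc.IH) (rule Suc.prems; simp)
  have "hol b (q + int (Suc k)) = crossing \<lfloor>b + \<alpha> * of_int (q + (int k + 1))\<rfloor> \<circ> hol b (q + int k)"
    using hol_succ[of b "q + int k"] by (simp add: algebra_simps)
  also have "\<lfloor>b + \<alpha> * of_int (q + (int k + 1))\<rfloor> = ?F + p"
    by (rule Suc.prems) auto
  also have "crossing (?F + p) \<circ> hol b (q + int k) =
      sg (- p) \<circ> crossing ?F \<circ> (sg p \<circ> sg (- p)) \<circ> hol b (int k) \<circ> sg p \<circ> hol b q"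
    unfolding crossing_add IH by (simp only: comp_assoc)
  also have "\<dots> = sg (- p) \<circ> (crossing ?F \<circ> hol b (int k)) \<circ> sg p \<circ> hol b q"
    by (simp only: sg_minus comp_id comp_assoc)
  also have "crossing ?F \<circ> hol b (int k) = hol b (int (Suc k))"
    using hol_succ[of b "int k"] by (simp add: add.commute)
  finally show ?case .
qed

text \<open>Comparing each passage with the next one takes N - 1 of the N passages, hence the bound
  on j. The row n p undoes the conjugation in \<open>hol_shift\<close>, so that a genuine power
  appears.\<close>

lemma label_periodic:
  fixes q N :: nat
  assumes "\<And>j. 1 \<le> j \<Longrightarrow> j \<le> int ((N - 1) * q) \<Longrightarrow>
    \<lfloor>b + \<alpha> * of_int (int q + j)\<rfloor> = \<lfloor>b + \<alpha> * of_int j\<rfloor> + p"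
  shows "n \<le> N \<Longrightarrow> label b (int (n * q)) (int n * p) = label b (int q) p ^^ n"
proof (induction n)
  case 0
  show ?case by (simp add: label_def)
next
  case (Suc n)
  have "n * q \<le> (N - 1) * q" using Suc.prems by (intro mult_le_mono1) simp
  then have le: "int (n * q) \<le> int ((N - 1) * q)" by (simp only: of_nat_le_iff)
  have "hol b (int q + int (n * q)) = sg (- p) \<circ> hol b (int (n * q)) \<circ> sg p \<circ> hol b (int q)"
  proof (rule hol_shift)
    fix j assume "1 \<le> j" "j \<le> int (n * q)"
    then show "\<lfloor>b + \<alpha> * of_int (int q + j)\<rfloor> = \<lfloor>b + \<alpha> * of_int j\<rfloor> + p"
      by (rule assms[OF _ order_trans[OF _ le]])
  qed
  then have "label b (int (Suc n * q)) (int (Suc n) * p) =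
      sg (int n * p) \<circ> (sg p \<circ> sg (- p)) \<circ> hol b (int (n * q)) \<circ> (sg p \<circ> hol b (int q))"
    using sg_add[of "int n * p" p] by (simp add: label_def algebra_simps comp_assoc)
  also have "\<dots> = label b (int (n * q)) (int n * p) \<circ> label b (int q) p"
    by (simp add: sg_minus label_def comp_assoc)
  also have "\<dots> = label b (int q) p ^^ Suc n"
    using Suc by (simp add: funpow_Suc_right del: funpow.simps)
  finally show ?case .
qed

text \<open>Near a convergent the flow almost closes up: flowing \<open>N\<close> times along the vector
  \<open>(q, q \<alpha>)\<close>, which is close to \<open>(q, p)\<close>, is a translation by \<open>N (q \<alpha> - p)\<close> for most points,
  since the path crosses the sides in the same order during each of the \<open>N\<close> passages and the
  resulting permutation is therefore an \<open>N\<close>-th power.\<close>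

lemma displacement_near_convergent:
  fixes N q :: nat and p :: int
  assumes N: "N > 0" "\<And>f. f permutes {1..d} \<Longrightarrow> f ^^ N = id"
    and q: "q \<ge> 1" and A: "A \<in> sets M" and i: "i \<in> {1..d}"
    and \<delta>_def: "\<delta> = real q * \<alpha> - of_int p" and t_def: "t = real N * real q / cos \<theta>"
  shows "emeasure lborel {z \<in> unit_square. (flow t (\<pi> (i, z)) \<in> A) \<noteq> (\<pi> (i, z) \<in> A)} \<le>
    ennreal (4 * real N * (real q * \<bar>\<delta>\<bar>)) +
    emeasure lborel {z. (z \<in> sec A i) \<noteq> (z + (0, real N * \<delta>) \<in> sec A i)}"
proof -
  define K where "K = (N - 1) * q"
  \<comment> \<open>Lines that meet the vertical x = k within about |\<delta>| of an integer height:
    there adding q \<alpha> = p + \<delta> may land in an unexpected row.\<close>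
  define B where "B k = {z \<in> unit_square. frac (snd z + (\<alpha> * real k - \<alpha> * fst z)) \<in> - {\<bar>\<delta>\<bar>..<1 - \<bar>\<delta>\<bar>}}" for k :: nat
  define bad where "bad = (\<Union>k\<in>{1..K}. B k)"
  \<comment> \<open>Starting points that the final vertical shift by N \<delta> could carry out of
    the square.\<close>
  define edge where "edge = {0..1::real} \<times> ({0..\<bar>real N * \<delta>\<bar>} \<union> {1 - \<bar>real N * \<delta>\<bar>..1})"
  \<comment> \<open>On x = 1 the floor of the final abscissa is one too large.\<close>
  define side where "side = {1::real} \<times> {0..1::real}"
  let ?T = "{z. (z \<in> sec A i) \<noteq> (z + (0, real N * \<delta>) \<in> sec A i)}"
  let ?D = "{z \<in> unit_square. (flow t (\<pi> (i, z)) \<in> A) \<noteq> (\<pi> (i, z) \<in> A)}"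
  have tc: "t * cos \<theta> = of_int (int (N * q))" using cos_nz by (simp add: t_def)
  have ts: "t * sin \<theta> = of_int (int N * p) + real N * \<delta>"
    using cos_nz by (simp add: t_def sin_eq \<delta>_def algebra_simps)
  have sub: "?D \<subseteq> bad \<union> edge \<union> side \<union> singular \<union> ?T"
  proof
    fix z assume zD: "z \<in> ?D"
    show "z \<in> bad \<union> edge \<union> side \<union> singular \<union> ?T"
    proof (rule ccontr)
      assume "\<not> ?thesis"
      then have nb: "z \<notin> bad" "z \<notin> edge" "z \<notin> side" "z \<notin> singular" "z \<notin> ?T" by auto
      obtain x y where z: "z = (x, y)" by (metis surj_pair)
      have xy: "0 \<le> x" "x < 1" "0 \<le> y" "y \<le> 1" using zD nb(3) by (auto simp: z side_def less_le)
      have ye: "0 \<le> y + real N * \<delta>" "y + real N * \<delta> < 1"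
        using nb(2) xy by (auto simp: z edge_def not_le abs_real_def split: if_splits)
      define b where "b = y - \<alpha> * x"
      have per: "\<lfloor>b + \<alpha> * of_int (int q + j)\<rfloor> = \<lfloor>b + \<alpha> * of_int j\<rfloor> + p"
        if "1 \<le> j" "j \<le> int K" for j
      proof -
        have "nat j \<in> {1..K}" using that by auto
        then have "z \<notin> B (nat j)" using nb(1) unfolding bad_def by blast
        then have "frac (b + \<alpha> * of_int j) \<in> {\<bar>\<delta>\<bar>..<1 - \<bar>\<delta>\<bar>}"
          using xy that by (simp add: B_def z b_def algebra_simps)
        from floor_add_small[OF this, of p] show ?thesis by (simp add: \<delta>_def algebra_simps)
      qed
      have fl: "\<lfloor>x + t * cos \<theta>\<rfloor> = int (N * q)" "\<lfloor>y + t * sin \<theta>\<rfloor> = int N * p"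
        unfolding tc ts floor_eq_iff using xy ye by (intro conjI; linarith)+
      have "label b (int (N * q)) (int N * p) = label b (int q) p ^^ N"
        by (rule label_periodic[of N q b p N, OF per order_refl]) (simp_all only: K_def)
      also have "\<dots> = id" by (rule N(2)[OF label_permutes])
      finally have nl: "next_label t i z = i"
        by (simp add: next_label_def z fl b_def)
      have "frac (x + t * cos \<theta>) = x" "frac (y + t * sin \<theta>) = y + real N * \<delta>"
        unfolding frac_def fl by (simp_all add: tc ts)
      then have "torus_flow t z = z + (0, real N * \<delta>)" by (simp add: torus_flow_def z)
      then have "flow t (\<pi> (i, z)) \<in> A \<longleftrightarrow> z + (0, real N * \<delta>) \<in> sec A i"
        using sec_regular[OF i _ nb(4), of t A] zD nl by simp
      moreover have "\<pi> (i, z) \<in> A \<longleftrightarrow> z \<in> sec A i" using zD by (simp add: sec_def)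
      ultimately show False using zD nb(5) by auto
    qed
  qed
  have secb: "sec A i \<in> sets borel" using A i by (auto simp: sets_M)
  have "(\<lambda>z. z + (0, real N * \<delta>)) -` sec A i \<in> sets borel"
    by (rule measurable_sets_borel[OF _ secb]) simp
  then have Tb: "?T \<in> sets borel"
  proof -
    have "?T = (sec A i - (\<lambda>z. z + (0, real N * \<delta>)) -` sec A i) \<union>
        ((\<lambda>z. z + (0, real N * \<delta>)) -` sec A i - sec A i)" by auto
    then show ?thesis using secb \<open>(\<lambda>z. z + (0, real N * \<delta>)) -` sec A i \<in> sets borel\<close> by simp
  qed
  have Bb: "B k \<in> sets borel" for k
    unfolding B_def by (intro borel_section) auto
  then have badb: "bad \<in> sets borel" unfolding bad_def by (intro sets.finite_UN) auto
  have edgeb: "edge \<in> sets borel" "side \<in> sets borel"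
    unfolding edge_def side_def by (intro borel_closed closed_Times closed_Un; simp)+
  have Bm: "emeasure lborel (B k) \<le> ennreal (2 * \<bar>\<delta>\<bar>)" for k
  proof -
    have "emeasure lborel (B k) = emeasure lborel (- {\<bar>\<delta>\<bar>..<1 - \<bar>\<delta>\<bar>} \<inter> {0..1})"
      unfolding B_def by (rule emeasure_frac_strip) auto
    also have "\<dots> \<le> emeasure lborel ({0..\<bar>\<delta>\<bar>} \<union> {1 - \<bar>\<delta>\<bar>..1})"
      by (intro emeasure_mono) auto
    also have "\<dots> \<le> ennreal (2 * \<bar>\<delta>\<bar>)" by (rule emeasure_boundary_strip) simp
    finally show ?thesis .
  qed
  have "emeasure lborel bad \<le> (\<Sum>k\<in>{1..K}. emeasure lborel (B k))"
    unfolding bad_def by (intro emeasure_subadditive_finite) (use Bb in auto)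
  also have "\<dots> \<le> (\<Sum>k\<in>{1..K}. ennreal (2 * \<bar>\<delta>\<bar>))" by (intro sum_mono Bm)
  also have "\<dots> = ennreal (\<Sum>k\<in>{1..K}. 2 * \<bar>\<delta>\<bar>)" by (rule sum_ennreal) simp
  also have "\<dots> \<le> ennreal (2 * real N * (real q * \<bar>\<delta>\<bar>))"
  proof (rule ennreal_leI)
    have "real K * (2 * \<bar>\<delta>\<bar>) \<le> real (N * q) * (2 * \<bar>\<delta>\<bar>)"
    proof (rule mult_right_mono)
      have "K \<le> N * q" unfolding K_def by (intro mult_le_mono1) simp
      then show "real K \<le> real (N * q)" by (simp only: of_nat_le_iff)
    qed simp
    then show "(\<Sum>k\<in>{1..K}. 2 * \<bar>\<delta>\<bar>) \<le> 2 * real N * (real q * \<bar>\<delta>\<bar>)" by (simp add: algebra_simps)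
  qed
  finally have bad: "emeasure lborel bad \<le> ennreal (2 * real N * (real q * \<bar>\<delta>\<bar>))" .
  \<comment> \<open>The bound is made the same as for \<open>bad\<close>, using q \<ge> 1; together
    they give the factor 4.\<close>
  have "emeasure lborel edge \<le> ennreal (2 * \<bar>real N * \<delta>\<bar>)"
    unfolding edge_def by (subst emeasure_lborel_strip) (auto intro: emeasure_boundary_strip)
  also have "\<dots> \<le> ennreal (2 * real N * (real q * \<bar>\<delta>\<bar>))"
  proof (rule ennreal_leI)
    have "real N * (1 * \<bar>\<delta>\<bar>) \<le> real N * (real q * \<bar>\<delta>\<bar>)"
      using q by (intro mult_left_mono mult_right_mono) auto
    then show "2 * \<bar>real N * \<delta>\<bar> \<le> 2 * real N * (real q * \<bar>\<delta>\<bar>)" by (simp add: abs_mult)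
  qed
  finally have edge: "emeasure lborel edge \<le> ennreal (2 * real N * (real q * \<bar>\<delta>\<bar>))" .
  have side: "emeasure lborel side = 0"
    unfolding side_def using lborel.emeasure_pair_measure_Times[of "{1::real}" lborel "{0..1::real}", unfolded lborel_prod]
    by simp
  have "emeasure lborel ?D \<le> emeasure lborel (bad \<union> edge \<union> side \<union> singular \<union> ?T)"
    using sub badb edgeb Tb by (intro emeasure_mono) auto
  also have "\<dots> \<le> emeasure lborel bad + emeasure lborel edge + emeasure lborel side
      + emeasure lborel singular + emeasure lborel ?T"
    using badb edgeb Tb by (intro emeasure_subadditive[THEN order_trans] add_mono) auto
  also have "\<dots> \<le> ennreal (2 * real N * (real q * \<bar>\<delta>\<bar>)) + ennreal (2 * real N * (real q * \<bar>\<delta>\<bar>)) + emeasure lborel ?T"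
    unfolding side singular_null by (simp add: add_mono bad edge)
  also have "\<dots> = ennreal (4 * real N * (real q * \<bar>\<delta>\<bar>)) + emeasure lborel ?T"
    by (simp flip: ennreal_plus)
  finally show ?thesis .
qed

lemma unbounded_imp_rigid:
  assumes "d > 0" and unb: "unbounded_partial_quotients \<alpha>"
  shows "rigid M flow"
proof -
  obtain N :: nat where N: "N > 0" "\<And>f. f permutes {1..d} \<Longrightarrow> f ^^ N = id"
    using exists_common_period[of "{1..d}"] by auto
  have "\<exists>q::nat. \<exists>p::int. q \<ge> 1 \<and> q \<ge> n \<and> real q * \<bar>real q * \<alpha> - of_int p\<bar> < 1 / real (Suc n)" for n
  proof -
    obtain q p :: int where "q \<ge> 1" "q \<ge> int n" "of_int q * \<bar>of_int q * \<alpha> - of_int p\<bar> < 1 / real (Suc n)"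
      by (rule unbounded_partial_quotients_approx[OF slope unb, of "1 / real (Suc n)" n]) auto
    then show ?thesis by (intro exI[of _ "nat q"] exI[of _ p]) auto
  qed
  then obtain q :: "nat \<Rightarrow> nat" and p :: "nat \<Rightarrow> int" where q: "q n \<ge> 1" "q n \<ge> n"
    and qp: "real (q n) * \<bar>real (q n) * \<alpha> - of_int (p n)\<bar> < 1 / real (Suc n)" for n by metis
  define \<delta> where "\<delta> n = real (q n) * \<alpha> - of_int (p n)" for n
  \<comment> \<open>The time in which the horizontal coordinate grows by N q. It is negative when
    cos \<theta> is, so its absolute value serves as the rigidity time.\<close>
  define t where "t n = real N * real (q n) / cos \<theta>" for n
  have qd: "real (q n) * \<bar>\<delta> n\<bar> < 1 / real (Suc n)" for n using qp by (simp add: \<delta>_def)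
  have dle: "\<bar>\<delta> n\<bar> < 1 / real (Suc n)" for n
  proof -
    have "1 * \<bar>\<delta> n\<bar> \<le> real (q n) * \<bar>\<delta> n\<bar>" using q by (intro mult_right_mono) auto
    then show ?thesis using qd[of n] by linarith
  qed
  have lim: "(\<lambda>n. displacement \<bar>t n\<bar> A) \<longlonglongrightarrow> 0" if A: "A \<in> sets M" for A
  proof -
    let ?D = "\<lambda>i n. {z \<in> unit_square. (flow (t n) (\<pi> (i, z)) \<in> A) \<noteq> (\<pi> (i, z) \<in> A)}"
    have "(\<lambda>n. measure lborel (?D i n)) \<longlonglongrightarrow> 0" if i: "i \<in> {1..d}" for i
    proof (rule LIMSEQ_I)
      fix e :: real assume "e > 0"
      have "sec A i \<in> sets borel" using A i by (auto simp: sets_M)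
      moreover have "bounded (sec A i)"
        by (rule bounded_subset[OF _ sec_subset]) (intro bounded_Times; simp)
      moreover have "e / 4 > 0" using \<open>e > 0\<close> by simp
      ultimately obtain r where r: "r > 0"
        "\<And>v. norm v < r \<Longrightarrow> emeasure lborel {z. (z \<in> sec A i) \<noteq> (z + v \<in> sec A i)} \<le> ennreal (e / 4)"
        by (rule translation_continuous_measure) blast
      \<comment> \<open>From q |\<delta>| < s the first error term is at most e/4, and from
        |\<delta>| < s the shift N \<delta> is shorter than r. The total e/2 is strictly below
        e.\<close>
      define s where "s = min (e / 16) r / real N"
      have "s > 0" using \<open>e > 0\<close> r N by (simp add: s_def)
      then obtain n0 where n0: "1 / real (Suc n0) < s" using nat_approx_posE by auto
      have "measure lborel (?D i n) < e" if "n \<ge> n0" for n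
      proof -
        have "1 / real (Suc n) \<le> 1 / real (Suc n0)" using that by (intro divide_left_mono) auto
        then have sm: "real (q n) * \<bar>\<delta> n\<bar> < s" "\<bar>\<delta> n\<bar> < s"
          using n0 qd[of n] dle[of n] by linarith+
        have "real N * s \<le> e / 16" "real N * s \<le> r" using N by (auto simp: s_def)
        moreover have "real N * (real (q n) * \<bar>\<delta> n\<bar>) < real N * s" "real N * \<bar>\<delta> n\<bar> < real N * s"
          using sm N by (auto intro: mult_strict_left_mono)
        ultimately have b: "4 * real N * (real (q n) * \<bar>\<delta> n\<bar>) \<le> e / 4" "real N * \<bar>\<delta> n\<bar> < r" by linarith+
        have "norm ((0, real N * \<delta> n) :: real \<times> real) < r" using b by (simp add: norm_prod_def abs_mult)
        note r(2)[OF this]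
        moreover note displacement_near_convergent[OF N q(1)[of n] A i \<delta>_def t_def]
        moreover have "ennreal (4 * real N * (real (q n) * \<bar>\<delta> n\<bar>)) \<le> ennreal (e / 4)"
          using b by (intro ennreal_leI)
        ultimately have "emeasure lborel (?D i n) \<le> ennreal (e / 4) + ennreal (e / 4)"
          by (meson add_mono order_trans)
        also have "\<dots> = ennreal (e / 2)" using \<open>e > 0\<close> by (simp flip: ennreal_plus)
        finally have "ennreal (measure lborel (?D i n)) \<le> ennreal (e / 2)"
          using emeasure_in_unit_square[of "?D i n"] by auto
        then have "measure lborel (?D i n) \<le> e / 2" using \<open>e > 0\<close> by (subst (asm) ennreal_le_iff) auto
        with \<open>e > 0\<close> show ?thesis by simp
      qed
      then show "\<exists>n0. \<forall>n\<ge>n0. norm (measure lborel (?D i n) - 0) < e" by auto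
    qed
    then have "(\<lambda>n. \<Sum>i\<in>{1..d}. measure lborel (?D i n)) \<longlonglongrightarrow> (\<Sum>i\<in>{1..d}. 0)"
      by (intro tendsto_sum) auto
    then have "(\<lambda>n. (\<Sum>i\<in>{1..d}. measure lborel (?D i n)) / d) \<longlonglongrightarrow> 0"
      by (intro tendsto_divide_zero) simp
    then have "(\<lambda>n. displacement (t n) A) \<longlonglongrightarrow> 0" by (simp only: displacement_eq[OF A])
    moreover have "displacement \<bar>t n\<bar> A = displacement (t n) A" for n
      using displacement_minus[OF A] by (simp add: abs_if)
    ultimately show ?thesis by simp
  qed
  have "real n \<le> \<bar>t n\<bar>" for n
  proof -
    have "real n * \<bar>cos \<theta>\<bar> \<le> real n * 1" by (intro mult_left_mono) auto
    also have "\<dots> \<le> real (q n) * 1" using q[of n] by simp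
    also have "\<dots> \<le> real (q n) * real N" using N by (intro mult_left_mono) auto
    finally show ?thesis using cos_nz by (simp add: t_def abs_mult field_simps)
  qed
  then have "filterlim (\<lambda>n. \<bar>t n\<bar>) at_top sequentially"
    using filterlim_at_top_mono[OF filterlim_real_sequentially] by (auto intro: always_eventually)
  with lim show ?thesis unfolding rigid_iff[OF \<open>d > 0\<close>] by (intro exI[of _ "\<lambda>n. \<bar>t n\<bar>"]) auto
qed

end

section \<open>Bounded partial quotients\<close>

lemma floor_add_jump:
  fixes y h :: real
  assumes "0 < h" "h < 1"
  shows "\<lfloor>y + h\<rfloor> = (if frac y \<in> {1 - h..<1} then \<lfloor>y\<rfloor> + 1 else \<lfloor>y\<rfloor>)"
proof -
  have y: "of_int \<lfloor>y\<rfloor> \<le> y" "y < of_int \<lfloor>y\<rfloor> + 1" by linarith+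
  show ?thesis
  proof (cases "1 - h \<le> y - of_int \<lfloor>y\<rfloor>")
    case True
    then have "\<lfloor>y + h\<rfloor> = \<lfloor>y\<rfloor> + 1"
      unfolding floor_eq_iff of_int_add of_int_1 using assms y by (intro conjI; linarith)
    moreover have "frac y \<in> {1 - h..<1}"
      using True frac_lt_1[of y] unfolding frac_def by (simp only: atLeastLessThan_iff)
    ultimately show ?thesis by simp
  next
    case False
    then have "\<lfloor>y + h\<rfloor> = \<lfloor>y\<rfloor>"
      unfolding floor_eq_iff using assms y by (intro conjI; linarith)
    with False show ?thesis by (simp add: frac_def)
  qed
qed

abbreviation open_unit_square :: "(real \<times> real) set" where
  "open_unit_square \<equiv> {0<..<1} \<times> {0<..<1}"

lemma unit_square_boundary_null: "emeasure lborel (unit_square - open_unit_square) = 0"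
proof -
  have 1: "{0..1} \<times> {0, 1} \<in> null_sets (lborel :: (real \<times> real) measure)"
    using lborel.emeasure_pair_measure_Times[of "{0..1::real}" lborel "{0, 1::real}", unfolded lborel_prod]
    by (intro null_setsI) (auto intro!: borel_closed closed_Times simp: emeasure_lborel_countable)
  have 2: "{0, 1} \<times> {0..1} \<in> null_sets (lborel :: (real \<times> real) measure)"
    using lborel.emeasure_pair_measure_Times[of "{0, 1::real}" lborel "{0..1::real}", unfolded lborel_prod]
    by (intro null_setsI) (auto intro!: borel_closed closed_Times simp: emeasure_lborel_countable)
  have "unit_square - open_unit_square \<subseteq> ({0..1} \<times> {0, 1}) \<union> ({0, 1} \<times> {0..1})" by force
  moreover have "open_unit_square \<in> sets borel" by (intro borel_open open_Times) auto
  ultimately have "unit_square - open_unit_square \<in> null_sets lborel"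
    using null_sets.Un[OF 1 2] by (auto intro: null_sets_subset)
  then show ?thesis by auto
qed

context square_tiled
begin

section \<open>Open squares as test sets\<close>

text \<open>Interiors, because closed squares overlap along glued sides and so would not separate
  labels.\<close>

definition open_square :: "nat \<Rightarrow> point set set" where
  "open_square i = (\<lambda>z. \<pi> (i, z)) ` open_unit_square"

lemma proj_interior_inj:
  assumes w: "w \<in> open_unit_square" and "(i, w) \<in> squares d" "(j, z) \<in> squares d"
    and eq: "\<pi> (j, z) = \<pi> (i, w)"
  shows "(j, z) = (i, w)"
proof -
  obtain a b x y where ab: "w = (a, b)" "z = (x, y)" by (metis surj_pair)
  have fr: "frac a = a" "frac b = b" using w by (auto simp: ab frac_eq)
  have "frac x = a" "frac y = b" using proj_frac[of j x y i a b] eq fr by (auto simp: ab)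
  moreover have "frac 1 = (0 :: real)" by simp
  ultimately have "x \<noteq> 1" "y \<noteq> 1" using w by (auto simp: ab)
  then have "x < 1" "y < 1" "0 \<le> x" "0 \<le> y" using assms(3) by (auto simp: ab squares_def)
  then have xy: "x = a" "y = b" using \<open>frac x = a\<close> \<open>frac y = b\<close> by (simp_all add: frac_eq)
  \<comment> \<open>An interior point can move to the upper right within its square, so the argument
    for a direction of motion applies. Half the distance to the far sides is one admissible
    displacement.\<close>
  have "(j, x, y) = (i, a, b)"
  proof (rule proj_inj_direction[where u = "(1 - a) / 2" and v = "(1 - b) / 2"])
    show "\<pi> (j, x, y) \<notin> vertices d \<tau> \<sigma>"
      using vertex_frac[of j x y] w fr by (auto simp: xy ab)
  qed (use assms in \<open>auto simp: ab xy squares_def field_simps\<close>)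
  then show ?thesis by (simp add: ab)
qed

lemma sec_open_square:
  assumes "i \<in> {1..d}" "j \<in> {1..d}"
  shows "sec (open_square i) j = (if j = i then open_unit_square else {})"
proof -
  have "\<pi> (j, z) \<in> open_square i \<longleftrightarrow> j = i \<and> z \<in> open_unit_square" if "z \<in> unit_square" for z
  proof
    assume "\<pi> (j, z) \<in> open_square i"
    then obtain w where w: "w \<in> open_unit_square" "\<pi> (j, z) = \<pi> (i, w)" by (auto simp: open_square_def)
    then have "(j, z) = (i, w)" using assms that by (intro proj_interior_inj) (auto simp: in_squares)
    with w show "j = i \<and> z \<in> open_unit_square" by simp
  qed (auto simp: open_square_def)
  moreover have "z \<in> unit_square" if "z \<in> open_unit_square" for z :: "real \<times> real" using that by auto
  ultimately show ?thesis by (auto simp: sec_def)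
qed

lemma open_square_sets:
  assumes "i \<in> {1..d}"
  shows "open_square i \<in> sets M"
proof -
  have "open_unit_square \<in> sets borel" by (intro borel_open open_Times) auto
  moreover have "open_square i \<subseteq> X" using assms by (force simp: open_square_def surface_def in_squares)
  ultimately show ?thesis using assms by (auto simp: sets_M sec_open_square)
qed

text \<open>Contains the points from which some copy changes squares. The null sets are added so
  that at a point of the unit square outside this set the whole label permutation is
  trivial.\<close>

definition moved :: "real \<Rightarrow> (real \<times> real) set" where
  "moved t = (\<Union>i\<in>{1..d}. {z \<in> unit_square. (flow t (\<pi> (i, z)) \<in> open_square i) \<noteq> (\<pi> (i, z) \<in> open_square i)})
     \<union> singular \<union> (unit_square - open_unit_square)"

lemma not_moved:
  assumes "z \<in> unit_square" "z \<notin> moved t" "i \<in> {1..d}"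
  shows "next_label t i z = i"
proof (rule ccontr)
  assume neq: "next_label t i z \<noteq> i"
  have z: "z \<in> open_unit_square" "z \<notin> singular" using assms by (auto simp: moved_def)
  then have "\<pi> (i, z) \<in> open_square i" by (auto simp: open_square_def)
  moreover have "flow t (\<pi> (i, z)) \<notin> open_square i"
    using sec_regular[OF assms(3,1) z(2), of t "open_square i"] neq next_label_in[OF assms(3), of t z]
    by (simp add: sec_open_square[OF assms(3)])
  ultimately show False using assms by (auto simp: moved_def)
qed

lemma moved_borel: "moved t \<in> sets borel"
proof -
  have "open_unit_square \<in> sets borel" by (intro borel_open open_Times) auto
  then show ?thesis
    unfolding moved_def using displacement_sec_borel[OF open_square_sets]
    by (intro sets.Un sets.finite_UN sets.Diff) auto
qed

text \<open>A displacement is an average over the d squares, so the contribution of one square is at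
  most d times the displacement.\<close>

lemma emeasure_moved:
  assumes "d > 0"
  shows "emeasure lborel (moved t) \<le> ennreal (real d * (\<Sum>i\<in>{1..d}. displacement t (open_square i)))"
proof -
  let ?D = "\<lambda>j i. {z \<in> unit_square. (flow t (\<pi> (j, z)) \<in> open_square i) \<noteq> (\<pi> (j, z) \<in> open_square i)}"
  have D: "?D j i \<in> sets borel" if "i \<in> {1..d}" "j \<in> {1..d}" for i j
    using that by (intro displacement_sec_borel open_square_sets)
  have "open_unit_square \<in> sets borel" by (intro borel_open open_Times) auto
  then have meas: "(\<Union>i\<in>{1..d}. ?D i i) \<in> sets lborel" "unit_square - open_unit_square \<in> sets lborel"
    using D by (auto intro!: sets.finite_UN)
  have "emeasure lborel (moved t) \<le> emeasure lborel (\<Union>i\<in>{1..d}. ?D i i) + emeasure lborel singular +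
      emeasure lborel (unit_square - open_unit_square)"
    unfolding moved_def using meas by (intro emeasure_subadditive[THEN order_trans] add_mono) auto
  also have "\<dots> = emeasure lborel (\<Union>i\<in>{1..d}. ?D i i)"
    by (simp only: singular_null unit_square_boundary_null add_0_right)
  also have "\<dots> \<le> (\<Sum>i\<in>{1..d}. emeasure lborel (?D i i))"
    using D by (intro emeasure_subadditive_finite) auto
  also have "\<dots> = (\<Sum>i\<in>{1..d}. ennreal (measure lborel (?D i i)))"
    by (intro sum.cong refl emeasure_in_unit_square) auto
  also have "\<dots> = ennreal (\<Sum>i\<in>{1..d}. measure lborel (?D i i))" by (rule sum_ennreal) simp
  also have "\<dots> \<le> ennreal (\<Sum>i\<in>{1..d}. real d * displacement t (open_square i))"
  proof (intro ennreal_leI sum_mono)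
    fix i assume i: "i \<in> {1..d}"
    have "measure lborel (?D i i) \<le> (\<Sum>j\<in>{1..d}. measure lborel (?D j i))"
      using i by (intro member_le_sum) auto
    also have "\<dots> = real d * displacement t (open_square i)"
      using assms by (simp add: displacement_eq[OF open_square_sets[OF i]])
    finally show "measure lborel (?D i i) \<le> real d * displacement t (open_square i)" .
  qed
  finally show ?thesis by (simp add: sum_distrib_left)
qed

text \<open>Raising the starting point by \<open>h\<close> past exactly one lattice point replaces one factor of the
  holonomy by the next crossing permutation, a different one since \<open>\<tau>\<close> and \<open>\<sigma>\<close> do not commute.
  So at least one of the two points is moved to another square.\<close>

lemma moved_near_jump:
  assumes comm: "\<tau> \<circ> \<sigma> \<noteq> \<sigma> \<circ> \<tau>"
    and h: "0 < h" "h < 1"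
    and z: "(x, y) \<in> unit_square" "(x, y + h) \<in> unit_square"
    and k: "1 \<le> k" "k \<le> m0" and m0: "m0 = \<lfloor>t * cos \<theta>\<rfloor>"
    and jump: "frac (y - \<alpha> * x + \<alpha> * of_int k) \<in> {1 - h..<1}"
    and only: "\<And>j. 1 \<le> j \<Longrightarrow> j \<le> m0 + 1 \<Longrightarrow> j \<noteq> k \<Longrightarrow> frac (y - \<alpha> * x + \<alpha> * of_int j) \<notin> {1 - h..<1}"
    and row: "frac (y + t * sin \<theta>) \<notin> {1 - h..<1}"
  shows "(x, y) \<in> moved t \<or> (x, y + h) \<in> moved t"
proof (rule ccontr)
  assume nm: "\<not> ?thesis"
  define b where "b = y - \<alpha> * x"
  define m where "m = \<lfloor>x + t * cos \<theta>\<rfloor>"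
  define n where "n = \<lfloor>y + t * sin \<theta>\<rfloor>"
  \<comment> \<open>As x runs through [0, 1], the last column is m0 or m0 + 1. Hence
    \<open>only\<close> covers column m0 + 1 while k is at most m0: in either case the jump at k
    lies on the path and is the only one.\<close>
  have m: "m0 \<le> m" "m \<le> m0 + 1"
    using z(1) by (auto simp: m_def m0 intro!: floor_mono) linarith
  have n: "\<lfloor>y + h + t * sin \<theta>\<rfloor> = n"
    using floor_add_jump[OF h, of "y + t * sin \<theta>"] row by (simp add: n_def algebra_simps)
  have "next_label t i (x, y) = i" "next_label t i (x, y + h) = i" if "i \<in> {1..d}" for i
    using not_moved[of _ t i] nm z that by blast+
  then have "label b m n i = label (b + h) m n i" if "i \<in> {1..d}" for i
    using that n by (simp add: next_label_def b_def m_def n_def algebra_simps)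
  then have "label b m n = label (b + h) m n"
    using permutes_not_in[OF label_permutes] by (intro ext) metis
  \<comment> \<open>Both paths end in row n, so the common power of \<sigma> is removed and the two
    products of crossings can be compared.\<close>
  then have "(sg (- n) \<circ> sg n) \<circ> hol b m = (sg (- n) \<circ> sg n) \<circ> hol (b + h) m"
    unfolding label_def by (simp only: comp_assoc)
  then have hol: "hol b m = hol (b + h) m" by (simp add: sg_minus)
  have fl: "\<lfloor>b + h + \<alpha> * of_int j\<rfloor> = \<lfloor>b + \<alpha> * of_int j\<rfloor> + (if j = k then 1 else 0)"
    if "1 \<le> j" "j \<le> m0 + 1" for j
    using floor_add_jump[OF h, of "b + \<alpha> * of_int j"] jump only[OF that] by (auto simp: b_def algebra_simps)
  have "crossing \<lfloor>b + \<alpha> * of_int k\<rfloor> = crossing \<lfloor>b + h + \<alpha> * of_int k\<rfloor>"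
  proof (rule int_iter_differ_once[where h = "\<lambda>j. crossing \<lfloor>b + \<alpha> * of_int j\<rfloor>" and
        h' = "\<lambda>j. crossing \<lfloor>b + h + \<alpha> * of_int j\<rfloor>" and k = k and m = "nat m"])
    show "int_iter (\<lambda>j. crossing \<lfloor>b + \<alpha> * of_int j\<rfloor>) (int (nat m)) =
      int_iter (\<lambda>j. crossing \<lfloor>b + h + \<alpha> * of_int j\<rfloor>) (int (nat m))"
      using hol k m unfolding hol_def by simp
  qed (use k m fl in \<open>auto simp: crossing_bij\<close>)
  then have "crossing (\<lfloor>b + \<alpha> * of_int k\<rfloor> + 1) = crossing \<lfloor>b + \<alpha> * of_int k\<rfloor>"
    using fl[of k] k by simp
  with crossing_succ_neq[OF comm] show False by blast
qed

section \<open>A lower bound at all large times\<close>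

text \<open>The m0 strips \<open>I k\<close> are disjoint and have measure h each. Off two more
  strips of measure h, each of their points lies in \<open>moved t\<close> or is raised into it, so
  m0 h is at most 2 h plus twice the measure of \<open>moved t\<close>.\<close>

lemma displacement_lower_bound:
  assumes "d > 0" and comm: "\<tau> \<circ> \<sigma> \<noteq> \<sigma> \<circ> \<tau>"
    and \<kappa>: "0 < \<kappa>" "\<kappa> < 1" "\<And>q p :: int. q \<ge> 1 \<Longrightarrow> \<kappa> \<le> of_int q * \<bar>of_int q * \<alpha> - of_int p\<bar>"
    and t: "t * cos \<theta> \<ge> 3"
  shows "\<kappa> / 8 \<le> real d * (\<Sum>i\<in>{1..d}. displacement t (open_square i))"
proof -
  define m0 where "m0 = \<lfloor>t * cos \<theta>\<rfloor>"
  \<comment> \<open>Column differences are below m0 + 1, so a point in two strips \<open>I k\<close>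
    and \<open>I k'\<close> would violate the inequality for \<kappa> at the difference of k and k'.
    As h is still of order \<kappa> / m0, the strips together keep measure of order
    \<kappa>.\<close>
  define h where "h = \<kappa> / (of_int m0 + 1)"
  have m0: "m0 \<ge> 3" using t by (simp add: m0_def le_floor_iff)
  have h: "0 < h" "h < 1" using \<kappa> m0 by (auto simp: h_def field_simps)
  define I where "I k = {z \<in> unit_square. frac (snd z + (\<alpha> * of_int k - \<alpha> * fst z)) \<in> {1 - h..<1}}" for k :: int
  \<comment> \<open>Points that raising by h could push out of the square.\<close>
  define edge where "edge = {0..1::real} \<times> {1 - h..1::real}"
  \<comment> \<open>Points for which the raise changes the final row.\<close>
  define row where "row = {z \<in> unit_square. frac (snd z + t * sin \<theta>) \<in> {1 - h..<1}}"
  let ?W = "moved t" and ?W' = "(\<lambda>z. z + (0, h)) -` moved t"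
  have separated: "k = k'" if "z \<in> I k" "z \<in> I k'" "k \<in> {1..m0 + 1}" "k' \<in> {1..m0 + 1}" for z k k'
  proof -
    have *: "False" if "z \<in> I k" "z \<in> I k'" "k < k'" "1 \<le> k" "k' \<le> m0 + 1" for k k'
    proof -
      define f where "f j = \<lfloor>snd z + (\<alpha> * of_int j - \<alpha> * fst z)\<rfloor>" for j
      have "\<bar>of_int (k' - k) * \<alpha> - of_int (f k' - f k)\<bar> < h"
        using that by (auto simp: I_def frac_def f_def abs_less_iff algebra_simps)
      moreover have "of_int (k' - k) \<le> of_int m0 + (1::real)" "0 < real_of_int (k' - k)"
        using that by auto
      ultimately have "of_int (k' - k) * \<bar>of_int (k' - k) * \<alpha> - of_int (f k' - f k)\<bar> < (of_int m0 + 1) * h"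
        by (intro mult_le_less_imp_less) auto
      also have "\<dots> = \<kappa>" using m0 by (simp add: h_def)
      finally show False using \<kappa>(3)[of "k' - k" "f k' - f k"] that by simp
    qed
    show ?thesis using *[of k k'] *[of k' k] that by (cases k k' rule: linorder_cases) auto
  qed
  have sub: "(\<Union>k\<in>{1..m0}. I k) \<subseteq> ?W \<union> ?W' \<union> edge \<union> row"
  proof
    fix z assume "z \<in> (\<Union>k\<in>{1..m0}. I k)"
    then obtain k where k: "k \<in> {1..m0}" "z \<in> I k" by blast
    obtain x y where z: "z = (x, y)" by (metis surj_pair)
    have xy: "(x, y) \<in> unit_square" using k by (simp add: I_def z)
    show "z \<in> ?W \<union> ?W' \<union> edge \<union> row"
    proof (cases "z \<in> edge \<union> row")
      case False
      have "(x, y) \<in> moved t \<or> (x, y + h) \<in> moved t"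
      proof (rule moved_near_jump[OF comm h xy _ _ _ m0_def])
        show "(x, y + h) \<in> unit_square" using False xy h by (auto simp: edge_def z)
        show "frac (y - \<alpha> * x + \<alpha> * of_int k) \<in> {1 - h..<1}"
          using k by (simp add: I_def z algebra_simps)
        show "frac (y - \<alpha> * x + \<alpha> * of_int j) \<notin> {1 - h..<1}" if "1 \<le> j" "j \<le> m0 + 1" "j \<noteq> k" for j
        proof
          assume "frac (y - \<alpha> * x + \<alpha> * of_int j) \<in> {1 - h..<1}"
          then have "z \<in> I j" using xy by (simp add: I_def z algebra_simps)
          with separated[of z j k] k that show False by auto
        qed
        show "frac (y + t * sin \<theta>) \<notin> {1 - h..<1}" using False xy by (auto simp: row_def z)
      qed (use k in auto)
      then show ?thesis by (auto simp: z)
    qed auto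
  qed
  have Ib: "I k \<in> sets borel" for k unfolding I_def by (intro borel_section) auto
  have rowb: "row \<in> sets borel" unfolding row_def by (intro borel_section) auto
  have edgeb: "edge \<in> sets borel" unfolding edge_def by (intro borel_closed closed_Times) auto
  have W'b: "?W' \<in> sets borel" by (rule measurable_sets_borel[OF _ moved_borel]) simp
  have one_strip: "emeasure lborel ({1 - h..<1} \<inter> {0..1}) = ennreal h"
  proof -
    have "{1 - h..<1} \<inter> {0..1} = {1 - h..<1}" using h by auto
    then show ?thesis using h by simp
  qed
  have nonneg: "0 \<le> real d * (\<Sum>i\<in>{1..d}. displacement t (open_square i))"
    by (intro mult_nonneg_nonneg sum_nonneg) (auto simp: displacement_def)
  have "ennreal (of_int m0 * h) = (\<Sum>k\<in>{1..m0}. ennreal h)"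
    using h m0 by (subst sum_ennreal) auto
  also have "\<dots> = (\<Sum>k\<in>{1..m0}. emeasure lborel (I k))"
    unfolding I_def by (intro sum.cong refl, subst emeasure_frac_strip) (auto simp: one_strip)
  also have "\<dots> = emeasure lborel (\<Union>k\<in>{1..m0}. I k)"
    using separated by (intro sum_emeasure) (auto simp: Ib disjoint_family_on_def)
  also have "\<dots> \<le> emeasure lborel (?W \<union> ?W' \<union> edge \<union> row)"
    using sub W'b edgeb rowb moved_borel by (intro emeasure_mono) auto
  also have "\<dots> \<le> emeasure lborel ?W + emeasure lborel ?W' + emeasure lborel edge + emeasure lborel row"
    using W'b edgeb rowb moved_borel by (intro emeasure_subadditive[THEN order_trans] add_mono) auto
  also have "\<dots> = emeasure lborel ?W + emeasure lborel ?W + ennreal h + ennreal h"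
  proof -
    have "emeasure lborel edge = ennreal h"
      unfolding edge_def using h by (subst emeasure_lborel_strip) auto
    moreover have "emeasure lborel row = ennreal h"
      unfolding row_def by (subst emeasure_frac_strip) (auto simp: one_strip)
    ultimately show ?thesis by (simp add: emeasure_lborel_vimage_plus[OF moved_borel])
  qed
  also have "\<dots> \<le> ennreal (real d * (\<Sum>i\<in>{1..d}. displacement t (open_square i))) +
      ennreal (real d * (\<Sum>i\<in>{1..d}. displacement t (open_square i))) + ennreal h + ennreal h"
    using emeasure_moved[OF \<open>d > 0\<close>, of t] by (intro add_mono) auto
  also have "\<dots> = ennreal (2 * (real d * (\<Sum>i\<in>{1..d}. displacement t (open_square i))) + 2 * h)"
    using h nonneg by (simp flip: ennreal_plus)
  finally have "of_int m0 * h \<le> 2 * (real d * (\<Sum>i\<in>{1..d}. displacement t (open_square i))) + 2 * h"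
    using h nonneg by (subst (asm) ennreal_le_iff) linarith+
  \<comment> \<open>The ratio (m0 - 2) / (m0 + 1) is at least 1/4 once m0 \<ge> 3, whence the
    condition t cos \<theta> \<ge> 3. The two copies of \<open>moved t\<close> halve this to
    \<kappa> / 8.\<close>
  moreover have "\<kappa> / 4 \<le> (of_int m0 - 2) * h"
  proof -
    have "\<kappa> * (of_int m0 + 1) \<le> \<kappa> * (4 * (of_int m0 - 2))"
      using \<kappa> m0 by (intro mult_left_mono) auto
    then show ?thesis using m0 by (simp add: h_def field_simps)
  qed
  ultimately show ?thesis by (simp add: algebra_simps)
qed

lemma bounded_imp_not_rigid:
  assumes "d > 0" and comm: "\<tau> \<circ> \<sigma> \<noteq> \<sigma> \<circ> \<tau>"
    and \<kappa>0: "0 < \<kappa>" "\<And>q p :: int. q \<ge> 1 \<Longrightarrow> \<kappa> \<le> of_int q * \<bar>of_int q * \<alpha> - of_int p\<bar>"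
  shows "\<not> rigid M flow"
proof
  assume "rigid M flow"
  then obtain Q :: "nat \<Rightarrow> real" where Q: "filterlim Q at_top sequentially"
    "\<And>A. A \<in> sets M \<Longrightarrow> (\<lambda>n. displacement (Q n) A) \<longlonglongrightarrow> 0"
    unfolding rigid_iff[OF \<open>d > 0\<close>] by blast
  \<comment> \<open>The sign makes the horizontal motion positive for Q n > 0; the displacement is
    even in time, so nothing else changes.\<close>
  define t where "t n = Q n * sgn (cos \<theta>)" for n
  have dis: "displacement (t n) A = displacement (Q n) A" if "A \<in> sets M" for n A
    using displacement_minus[OF that, of "Q n"] cos_nz by (simp add: t_def sgn_if)
  \<comment> \<open>A constant below 1 keeps the strip height h below 1.\<close>
  define c where "c = min \<kappa> (1 / 2)"
  have c: "0 < c" "c < 1" "\<And>q p :: int. q \<ge> 1 \<Longrightarrow> c \<le> of_int q * \<bar>of_int q * \<alpha> - of_int p\<bar>"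
    using \<kappa>0 by (auto simp: c_def min_le_iff_disj)
  have "(\<lambda>n. real d * (\<Sum>i\<in>{1..d}. displacement (Q n) (open_square i))) \<longlonglongrightarrow> real d * (\<Sum>i\<in>{1..d}. 0)"
    using Q(2) open_square_sets by (intro tendsto_intros) auto
  then have "\<forall>\<^sub>F n in sequentially. real d * (\<Sum>i\<in>{1..d}. displacement (Q n) (open_square i)) < c / 8"
    using c(1) by (intro order_tendstoD(2)) auto
  moreover have "\<forall>\<^sub>F n in sequentially. 3 / \<bar>cos \<theta>\<bar> \<le> Q n"
    using Q(1) by (simp add: filterlim_at_top)
  ultimately have "\<forall>\<^sub>F n in sequentially. False"
  proof eventually_elim
    case (elim n)
    have "t n * cos \<theta> = Q n * \<bar>cos \<theta>\<bar>" by (simp add: t_def abs_sgn mult.commute)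
    then have "t n * cos \<theta> \<ge> 3" using elim(2) cos_nz by (simp add: field_simps)
    then have "c / 8 \<le> real d * (\<Sum>i\<in>{1..d}. displacement (t n) (open_square i))"
      by (intro displacement_lower_bound \<open>d > 0\<close> comm c)
    moreover have "(\<Sum>i\<in>{1..d}. displacement (t n) (open_square i)) =
        (\<Sum>i\<in>{1..d}. displacement (Q n) (open_square i))"
      by (intro sum.cong refl dis open_square_sets)
    ultimately show False
      using elim(1) by (metis not_le)
  qed
  then show False by simp
qed

end

theorem theorem1:
  fixes d :: nat and \<tau> \<sigma> :: "nat \<Rightarrow> nat" and \<theta> :: real
  assumes "\<tau> permutes {1..d}" and "\<sigma> permutes {1..d}"
    and "connected_space (surface_topology d \<tau> \<sigma>)"
    and "genus d \<tau> \<sigma> \<ge> 2"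
    and "tan \<theta> \<notin> \<rat>"
  shows "rigid (surface_area d \<tau> \<sigma>) (linear_flow d \<tau> \<sigma> \<theta>) \<longleftrightarrow>
    unbounded_partial_quotients (tan \<theta>)"
proof -
  interpret square_tiled d \<tau> \<sigma> \<theta>
    using assms by unfold_locales
  have comm: "\<tau> \<circ> \<sigma> \<noteq> \<sigma> \<circ> \<tau>"
    using assms by (intro genus_ge_2_not_commute)
  \<comment> \<open>Without squares there are no vertices, and the formula for \<open>genus\<close>
    returns 1.\<close>
  have "d > 0"
    using assms(4) by (cases "d = 0") (auto simp: genus_def euler_char_def)
  show ?thesis
  proof
    assume rigid: "rigid M flow"
    show "unbounded_partial_quotients \<alpha>"
    proof (rule ccontr)
      assume "\<not> ?thesis"
      then obtain \<kappa> :: real where "\<kappa> > 0"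
        "\<And>q p :: int. q \<ge> 1 \<Longrightarrow> \<kappa> \<le> of_int q * \<bar>of_int q * \<alpha> - of_int p\<bar>"
        using bounded_partial_quotients_approx[OF slope] by metis
      then show False using bounded_imp_not_rigid[OF \<open>d > 0\<close> comm] rigid by blast
    qed
  qed (rule unbounded_imp_rigid[OF \<open>d > 0\<close>])
qed

end
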